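(* For each integer $n$ with $2\le n\le 7$, the congruence two subgroup $\Gamma^n_2$ of $\Gamma^n=PO_{n,1}\mathbb{Z}$ is a hyperbolic Coxeter group with Coxeter polytope the right-angled polytope $P^n$. That is, $P^n$ is a right-angled hyperbolic polytope, $P^n$ is a fundamental polytope for the action of $\Gamma^n_2$ on $H^n$, and $\Gamma^n_2$ is the group generated by the reflections in the sides of $P^n$.
   Context: Work in $\mathbb{R}^{n+1}$ with the Lorentzian inner product $\langle x,y\rangle=x_1y_1+\dots+x_ny_n-x_{n+1}y_{n+1}$ and the hyperboloid model $H^n=\{x\in\mathbb{R}^{n+1}:\langle x,x\rangle=-1,\ x_{n+1}>0\}$; isometries of $H^n$ are the positive Lorentzian $(n+1)\times(n+1)$ matrices (those preserving $\langle\cdot,\cdot\rangle$ and the sign of the last coordinate on time-like vectors). $\Gamma^n=PO_{n,1}\mathbb{Z}$ denotes the group of positive Lorentzian $(n+1)\times(n+1)$ matrices with integer entries, and $\Gamma^n_2$ is its subgroup of matrices congruent to the identity matrix modulo $2$. A polytope in $H^n$ is a convex polyhedron with finitely many sides and finite volume (equivalently, the convex hull of finitely many actual and ideal vertices); it is right-angled if all dihedral angles between adjacent sides are $0$ or $\pi/2$. Let $\Delta^n$ be the simplex $\Delta^n=\{x\in H^n: x_1\ge x_2\ge\dots\ge x_n\ge 0,\ x_1+x_2+x_3\le x_{n+1}\}$ for $n\ge 3$, and $\Delta^2=\{x\in H^2: x_1\ge x_2\ge 0,\ x_1+x_2\le x_3\}$ (its vertices are represented by $e_1+e_{n+1}$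 (ideal), $e_1+e_2+2e_{n+1}$, $e_1+\dots+e_k+3e_{n+1}$ for $3\le k\le n$, and $e_{n+1}$). For $n\ge3$ let $\Sigma^n$ be the finite group generated by the coordinate transpositions $x_i\leftrightarrow x_{i+1}$ ($1\le i\le n-1$) and the reflection $x\mapsto x-\langle x,w\rangle w$ with $w=e_1+e_2+e_3+e_{n+1}$ (i.e. the reflections in all sides of $\Delta^n$ except the side in $x_n=0$); let $\Sigma^2$ be the group of order $2$ generated by $x_1\leftrightarrow x_2$. Define $P^n=\bigcup_{\gamma\in\Sigma^n}\gamma(\Delta^n)$. *)

theory Defs
  imports Complex_Main
begin

text \<open>Points of R^(n+1) are functions nat => real, coordinates indexed 1..n+1
  (all other coordinates are 0); (n+1)x(n+1) matrices are functions nat => nat => real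
  with entries indexed by {1..n+1} (all other entries 0).\<close>

definition lor :: "nat \<Rightarrow> (nat \<Rightarrow> real) \<Rightarrow> (nat \<Rightarrow> real) \<Rightarrow> real" where
  "lor n x y = (\<Sum>i=1..n. x i * y i) - x (n+1) * y (n+1)"

definition is_vec :: "nat \<Rightarrow> (nat \<Rightarrow> real) \<Rightarrow> bool" where
  "is_vec n x \<longleftrightarrow> (\<forall>i. i \<notin> {1..n+1} \<longrightarrow> x i = 0)"

definition hyp :: "nat \<Rightarrow> (nat \<Rightarrow> real) set" where
  "hyp n = {x. is_vec n x \<and> lor n x x = -1 \<and> x (n+1) > 0}"

definition is_mat :: "nat \<Rightarrow> (nat \<Rightarrow> nat \<Rightarrow> real) \<Rightarrow> bool" where
  "is_mat n A \<longleftrightarrow> (\<forall>i j. (i \<notin> {1..n+1} \<or> j \<notin> {1..n+1}) \<longrightarrow> A i j = 0)"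

definition mat_vec :: "nat \<Rightarrow> (nat \<Rightarrow> nat \<Rightarrow> real) \<Rightarrow> (nat \<Rightarrow> real) \<Rightarrow> (nat \<Rightarrow> real)" where
  "mat_vec n A x = (\<lambda>i. if i \<in> {1..n+1} then (\<Sum>j=1..n+1. A i j * x j) else 0)"

definition mat_mult :: "nat \<Rightarrow> (nat \<Rightarrow> nat \<Rightarrow> real) \<Rightarrow> (nat \<Rightarrow> nat \<Rightarrow> real) \<Rightarrow> (nat \<Rightarrow> nat \<Rightarrow> real)" where
  "mat_mult n A B = (\<lambda>i j. if i \<in> {1..n+1} \<and> j \<in> {1..n+1} then (\<Sum>k=1..n+1. A i k * B k j) else 0)"

definition idm :: "nat \<Rightarrow> nat \<Rightarrow> nat \<Rightarrow> real" where
  "idm n = (\<lambda>i j. if i = j \<and> i \<in> {1..n+1} then 1 else 0)"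

definition lorentzian :: "nat \<Rightarrow> (nat \<Rightarrow> nat \<Rightarrow> real) \<Rightarrow> bool" where
  "lorentzian n A \<longleftrightarrow> is_mat n A \<and>
     (\<forall>x y. is_vec n x \<longrightarrow> is_vec n y \<longrightarrow> lor n (mat_vec n A x) (mat_vec n A y) = lor n x y)"

definition positive_lorentzian :: "nat \<Rightarrow> (nat \<Rightarrow> nat \<Rightarrow> real) \<Rightarrow> bool" where
  "positive_lorentzian n A \<longleftrightarrow> lorentzian n A \<and>
     (\<forall>x. is_vec n x \<longrightarrow> lor n x x < 0 \<longrightarrow> sgn (mat_vec n A x (n+1)) = sgn (x (n+1)))"

definition Gamma :: "nat \<Rightarrow> (nat \<Rightarrow> nat \<Rightarrow> real) set" where
  "Gamma n = {A. positive_lorentzian n A \<and> (\<forall>i j. A i j \<in> \<int>)}"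

definition Gamma2 :: "nat \<Rightarrow> (nat \<Rightarrow> nat \<Rightarrow> real) set" where
  "Gamma2 n = {A \<in> Gamma n. \<forall>i\<in>{1..n+1}. \<forall>j\<in>{1..n+1}.
                  \<exists>k::int. A i j - idm n i j = 2 * of_int k}"

inductive_set gen_grp :: "nat \<Rightarrow> (nat \<Rightarrow> nat \<Rightarrow> real) set \<Rightarrow> (nat \<Rightarrow> nat \<Rightarrow> real) set"
  for n :: nat and S :: "(nat \<Rightarrow> nat \<Rightarrow> real) set" where
  gen_id: "idm n \<in> gen_grp n S"
| gen_gen: "s \<in> S \<Longrightarrow> s \<in> gen_grp n S"
| gen_mult: "a \<in> gen_grp n S \<Longrightarrow> b \<in> gen_grp n S \<Longrightarrow> mat_mult n a b \<in> gen_grp n S"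
| gen_inv: "a \<in> gen_grp n S \<Longrightarrow> is_mat n b \<Longrightarrow> mat_mult n a b = idm n \<Longrightarrow> b \<in> gen_grp n S"

definition act :: "nat \<Rightarrow> (nat \<Rightarrow> nat \<Rightarrow> real) \<Rightarrow> (nat \<Rightarrow> real) set \<Rightarrow> (nat \<Rightarrow> real) set" where
  "act n A S = mat_vec n A ` S"

text \<open>Matrix of the map x |-> x - c <x,w> w.\<close>
definition lin_refl :: "nat \<Rightarrow> real \<Rightarrow> (nat \<Rightarrow> real) \<Rightarrow> (nat \<Rightarrow> nat \<Rightarrow> real)" where
  "lin_refl n c w = (\<lambda>a b. if a \<in> {1..n+1} \<and> b \<in> {1..n+1}
       then idm n a b - c * w a * (if b = n+1 then - w b else w b) else 0)"

definition hrefl :: "nat \<Rightarrow> (nat \<Rightarrow> real) \<Rightarrow> (nat \<Rightarrow> nat \<Rightarrow> real)" where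
  "hrefl n w = lin_refl n (2 / lor n w w) w"

definition swap_mat :: "nat \<Rightarrow> nat \<Rightarrow> (nat \<Rightarrow> nat \<Rightarrow> real)" where
  "swap_mat n i = (\<lambda>a b. if a \<in> {1..n+1} \<and>
       b = (if a = i then i+1 else if a = i+1 then i else a) then 1 else 0)"

definition unit_vec :: "nat \<Rightarrow> nat \<Rightarrow> real" where
  "unit_vec k = (\<lambda>i. if i = k then 1 else 0)"

definition Delta :: "nat \<Rightarrow> (nat \<Rightarrow> real) set" where
  "Delta n = (if n = 2 then {x \<in> hyp 2. x 1 \<ge> x 2 \<and> x 2 \<ge> 0 \<and> x 1 + x 2 \<le> x 3}
     else {x \<in> hyp n. (\<forall>i\<in>{1..<n}. x i \<ge> x (i+1)) \<and> x n \<ge> 0 \<and> x 1 + x 2 + x 3 \<le> x (n+1)})"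

definition Sigma_gens :: "nat \<Rightarrow> (nat \<Rightarrow> nat \<Rightarrow> real) set" where
  "Sigma_gens n = (if n = 2 then {swap_mat 2 1}
     else {swap_mat n i | i. 1 \<le> i \<and> i \<le> n - 1} \<union>
          {lin_refl n 1 (\<lambda>i. unit_vec 1 i + unit_vec 2 i + unit_vec 3 i + unit_vec (n+1) i)})"

definition SigmaG :: "nat \<Rightarrow> (nat \<Rightarrow> nat \<Rightarrow> real) set" where
  "SigmaG n = gen_grp n (Sigma_gens n)"

definition Pn :: "nat \<Rightarrow> (nat \<Rightarrow> real) set" where
  "Pn n = (\<Union>g\<in>SigmaG n. act n g (Delta n))"

text \<open>Topology on H^n via the hyperbolic metric: cosh d(x,y) = - <x,y>.
  h_int n M S: interior of S relative to the ambient set M (a subset of H^n).\<close>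
definition h_int :: "nat \<Rightarrow> (nat \<Rightarrow> real) set \<Rightarrow> (nat \<Rightarrow> real) set \<Rightarrow> (nat \<Rightarrow> real) set" where
  "h_int n M S = {x \<in> S \<inter> M. \<exists>\<epsilon>>0. \<forall>y\<in>M. - lor n x y < 1 + \<epsilon> \<longrightarrow> y \<in> S}"

definition h_closure :: "nat \<Rightarrow> (nat \<Rightarrow> real) set \<Rightarrow> (nat \<Rightarrow> real) set" where
  "h_closure n S = {x \<in> hyp n. \<forall>\<epsilon>>0. \<exists>y\<in>S. - lor n x y < 1 + \<epsilon>}"

text \<open>Polytope: convex hull in H^n of finitely many actual and ideal vertices
  (positive cone spanned by finitely many future-pointing non-space-like vectors, intersected
  with H^n), with nonempty interior.\<close>
definition polytope :: "nat \<Rightarrow> (nat \<Rightarrow> real) set \<Rightarrow> bool" where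
  "polytope n P \<longleftrightarrow>
     (\<exists>V. finite V \<and> V \<subseteq> {v. is_vec n v \<and> lor n v v \<le> 0 \<and> v (n+1) > 0} \<and>
          P = {x \<in> hyp n. \<exists>c. (\<forall>v\<in>V. c v \<ge> 0) \<and> x = (\<lambda>i. \<Sum>v\<in>V. c v * v i)}) \<and>
     h_int n (hyp n) P \<noteq> {}"

definition side_normals :: "nat \<Rightarrow> (nat \<Rightarrow> real) set \<Rightarrow> (nat \<Rightarrow> real) set" where
  "side_normals n P = {e. is_vec n e \<and> lor n e e = 1 \<and> (\<forall>x\<in>P. lor n x e \<le> 0) \<and>
      h_int n (hyp n \<inter> {y. lor n y e = 0}) (P \<inter> {y. lor n y e = 0}) \<noteq> {}}"

text \<open>Sides with normals e, f are adjacent if they meet in a ridge (a set with nonempty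
  interior in the codimension-two plane e^perp \<inter> f^perp \<inter> H^n).  The dihedral angle theta between
  adjacent sides satisfies cos theta = - <e,f>.\<close>
definition adjacent_sides :: "nat \<Rightarrow> (nat \<Rightarrow> real) set \<Rightarrow> (nat \<Rightarrow> real) \<Rightarrow> (nat \<Rightarrow> real) \<Rightarrow> bool" where
  "adjacent_sides n P e f \<longleftrightarrow> e \<noteq> f \<and>
     h_int n (hyp n \<inter> {y. lor n y e = 0} \<inter> {y. lor n y f = 0})
             (P \<inter> {y. lor n y e = 0} \<inter> {y. lor n y f = 0}) \<noteq> {}"

definition right_angled_polytope :: "nat \<Rightarrow> (nat \<Rightarrow> real) set \<Rightarrow> bool" where
  "right_angled_polytope n P \<longleftrightarrow> polytope n P \<and>
     (\<forall>e\<in>side_normals n P. \<forall>f\<in>side_normals n P. adjacent_sides n P e f \<longrightarrow>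
        arccos (- lor n e f) = 0 \<or> arccos (- lor n e f) = pi / 2)"

text \<open>Fundamental polytope (Ratcliffe): P is a polytope whose interior is a locally finite
  fundamental domain for the group G acting on H^n.\<close>
definition fundamental_polytope :: "nat \<Rightarrow> (nat \<Rightarrow> nat \<Rightarrow> real) set \<Rightarrow> (nat \<Rightarrow> real) set \<Rightarrow> bool" where
  "fundamental_polytope n G P \<longleftrightarrow> polytope n P \<and>
     (\<forall>g\<in>G. \<forall>h\<in>G. g \<noteq> h \<longrightarrow>
        act n g (h_int n (hyp n) P) \<inter> act n h (h_int n (hyp n) P) = {}) \<and>
     hyp n = (\<Union>g\<in>G. act n g (h_closure n (h_int n (hyp n) P))) \<and>
     (\<forall>x\<in>hyp n. \<exists>\<epsilon>>0. finite {g\<in>G. \<exists>y\<in>act n g (h_closure n (h_int n (hyp n) P)).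
                                       - lor n x y < 1 + \<epsilon>})"

definition side_reflections :: "nat \<Rightarrow> (nat \<Rightarrow> real) set \<Rightarrow> (nat \<Rightarrow> nat \<Rightarrow> real) set" where
  "side_reflections n P = hrefl n ` side_normals n P"

end

theory Submission
  imports Defs "HOL-Analysis.Convex" "Jordan_Normal_Form.Determinant"
begin

text \<open>Let \<open>\<kappa> = e\<^sub>1 + \<dots> + e\<^sub>n + 3 e\<^sub>n\<^sub>+\<^sub>1\<close>, which is time-like with norm \<open>n - 9\<close> and characteristic:
  \<open>\<langle>u,u\<rangle> \<equiv> \<langle>u,\<kappa>\<rangle> mod 2\<close> for integral \<open>u\<close>.  Call an integral \<open>e\<close> with \<open>\<langle>e,e\<rangle> = 1\<close> and
  \<open>\<langle>e,\<kappa>\<rangle> = -1\<close> exceptional (these are the classes of the lines on a del Pezzo surface).  The group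
  \<open>\<Sigma>\<^sup>n\<close> fixes \<open>\<kappa>\<close>, hence permutes the exceptional vectors, and \<open>P\<^sup>n\<close> turns out to be the set of
  all \<open>x\<close> with \<open>\<langle>x,e\<rangle> \<le> 0\<close> for all of them; they are therefore the side normals.

  Every integral unit vector \<open>r\<close> with \<open>\<langle>r,\<kappa>\<rangle> < 0\<close> is nonpositive on \<open>P\<^sup>n\<close>: as long as
  \<open>\<langle>r,\<kappa>\<rangle> \<noteq> -1\<close> it is space-like, so it meets some exceptional \<open>e\<close> positively, and reflecting in
  \<open>e\<close> decreases \<open>-\<langle>r,\<kappa>\<rangle>\<close> without making it negative (Cauchy-Schwarz in the complement of \<open>\<kappa>\<close>).
  Consequently an element of \<open>\<Gamma>\<^sup>n\<^sub>2\<close> that maps an interior point of \<open>P\<^sup>n\<close> to an interior point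
  permutes the exceptional vectors; they are pairwise incongruent modulo 2 (this needs \<open>n \<le> 7\<close>), so
  it is the identity.  Covering, generation by the reflections and local finiteness all follow by
  descent along the discrete orbit of \<open>\<kappa>\<close>.\<close>

hide_const (open) Matrix.unit_vec
hide_fact (open) Matrix.unit_vec_def

section \<open>Lorentzian linear algebra\<close>

text \<open>Named linear combination, so that \<open>lor\<close> and \<open>mat_vec\<close> expand
  over it by rewriting without unfolding functions. Negation is written
  \<open>lc (-1) x 0 x\<close>.\<close>

definition lc :: "real \<Rightarrow> (nat \<Rightarrow> real) \<Rightarrow> real \<Rightarrow> (nat \<Rightarrow> real) \<Rightarrow> nat \<Rightarrow> real" where
  "lc a x b y = (\<lambda>i. a * x i + b * y i)"

lemma lor_commute: "lor n x y = lor n y x"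
  by (simp add: lor_def mult.commute)

lemma lor_lc_left [simp]: "lor n (lc a x b y) z = a * lor n x z + b * lor n y z"
  by (simp add: lor_def lc_def sum.distrib sum_distrib_left algebra_simps)

lemma lor_lc_right [simp]: "lor n z (lc a x b y) = a * lor n z x + b * lor n z y"
  by (metis lor_commute lor_lc_left)

lemma is_vec_lc [simp]: "is_vec n x \<Longrightarrow> is_vec n y \<Longrightarrow> is_vec n (lc a x b y)"
  by (simp add: is_vec_def lc_def)

lemma lor_zero [simp]: "lor n (\<lambda>_. 0) z = 0"
  by (simp add: lor_def)

text \<open>Orthogonality equates the spatial product of \<open>a\<close> and \<open>v\<close> with
  the product of their time coordinates; Cauchy-Schwarz and the dominant time coordinate of
  \<open>v\<close> do the rest.\<close>

lemma time_orthogonal_nonneg: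
  assumes "lor n v v < 0" and "lor n a v = 0"
  shows "lor n a a \<ge> 0"
proof -
  let ?A = "\<Sum>i=1..n. (a i)\<^sup>2" and ?V = "\<Sum>i=1..n. (v i)\<^sup>2"
  have 1: "(\<Sum>i=1..n. a i * v i) = a (n+1) * v (n+1)"
    using assms(2) by (simp add: lor_def)
  have V: "?V < (v (n+1))\<^sup>2"
    using assms(1) by (simp add: lor_def power2_eq_square)
  have "(a (n+1) * v (n+1))\<^sup>2 \<le> ?A * ?V"
    unfolding 1[symmetric] by (rule Cauchy_Schwarz_ineq_sum)
  also have "\<dots> \<le> ?A * (v (n+1))\<^sup>2"
    using V by (intro mult_left_mono sum_nonneg) auto
  finally have "(a (n+1))\<^sup>2 * (v (n+1))\<^sup>2 \<le> ?A * (v (n+1))\<^sup>2"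
    by (simp add: power_mult_distrib)
  moreover have "0 \<le> ?V" by (simp add: sum_nonneg)
  hence "(v (n+1))\<^sup>2 > 0"
    using V by linarith
  ultimately have "(a (n+1))\<^sup>2 \<le> ?A"
    by (rule mult_right_le_imp_le)
  thus ?thesis
    by (simp add: lor_def power2_eq_square)
qed

text \<open>The equality case of the same estimate: the form is positive definite on the complement
  of a time-like vector.\<close>

lemma time_orthogonal_null:
  assumes "lor n v v < 0" and "lor n a v = 0" and "lor n a a = 0" and "is_vec n a"
  shows "a = (\<lambda>_. 0)"
proof -
  let ?A = "\<Sum>i=1..n. (a i)\<^sup>2" and ?V = "\<Sum>i=1..n. (v i)\<^sup>2"
  have 1: "(\<Sum>i=1..n. a i * v i) = a (n+1) * v (n+1)"
    using assms(2) by (simp add: lor_def)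
  have V: "?V < (v (n+1))\<^sup>2"
    using assms(1) by (simp add: lor_def power2_eq_square)
  have A: "?A = (a (n+1))\<^sup>2"
    using assms(3) by (simp add: lor_def power2_eq_square)
  have "(a (n+1) * v (n+1))\<^sup>2 \<le> ?A * ?V"
    unfolding 1[symmetric] by (rule Cauchy_Schwarz_ineq_sum)
  hence "(a (n+1) * v (n+1))\<^sup>2 \<le> (a (n+1))\<^sup>2 * ?V"
    unfolding A .
  hence "(a (n+1))\<^sup>2 * ((v (n+1))\<^sup>2 - ?V) \<le> 0"
    by (simp add: power_mult_distrib algebra_simps)
  hence "(a (n+1))\<^sup>2 \<le> 0"
    using V by (simp add: mult_le_0_iff)
  hence t: "a (n+1) = 0" by simp
  hence "\<forall>i\<in>{1..n}. (a i)\<^sup>2 = 0"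
    using A sum_nonneg_eq_0_iff[of "{1..n}" "\<lambda>i. (a i)\<^sup>2"] by simp
  hence s: "\<forall>i\<in>{1..n}. a i = 0" by simp
  have "a i = 0" for i
  proof (cases "i \<in> {1..n+1}")
    case True
    thus ?thesis using s t by (cases "i = n+1") auto
  next
    case False
    thus ?thesis using assms(4) unfolding is_vec_def by blast
  qed
  thus ?thesis by blast
qed

text \<open>The classical argument in the definite complement of \<open>v\<close>: the norm of
  \<open><b,b> a - <a,b> b\<close> is nonnegative and equals \<open><b,b>\<close> times the Gram
  determinant.\<close>

lemma lor_Cauchy_Schwarz_orthogonal:
  assumes v: "lor n v v < 0" and "lor n a v = 0" "lor n b v = 0" "is_vec n b"
  shows "(lor n a b)\<^sup>2 \<le> lor n a a * lor n b b"
proof (cases "lor n b b = 0")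
  case True
  hence "b = (\<lambda>_. 0)"
    using time_orthogonal_null assms by blast
  thus ?thesis by (simp add: lor_commute[of n a "\<lambda>_. 0"])
next
  case False
  let ?c = "lc (lor n b b) a (- lor n a b) b"
  have pos: "lor n b b > 0"
    using time_orthogonal_nonneg[OF v assms(3)] False by simp
  have "0 \<le> lor n ?c ?c"
    using assms by (intro time_orthogonal_nonneg[OF v]) simp
  also have "lor n ?c ?c = lor n b b * (lor n a a * lor n b b - (lor n a b)\<^sup>2)"
    by (simp add: lor_commute[of n b a] algebra_simps power2_eq_square)
  finally show ?thesis
    using pos by (simp add: zero_le_mult_iff)
qed

text \<open>Cauchy-Schwarz for the projections of \<open>a\<close> and \<open>b\<close> to the
  complement of \<open>v\<close>. They are scaled by \<open>lor n v v\<close> to avoid division, and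
  the resulting square is cancelled at the end.\<close>

lemma lor_reverse_Cauchy_Schwarz:
  assumes v: "lor n v v < 0" and "is_vec n v" "is_vec n b"
  shows "(lor n a b * lor n v v - lor n a v * lor n b v)\<^sup>2
       \<le> (lor n a a * lor n v v - (lor n a v)\<^sup>2) * (lor n b b * lor n v v - (lor n b v)\<^sup>2)"
proof -
  define a' where "a' = lc (lor n v v) a (- lor n a v) v"
  define b' where "b' = lc (lor n v v) b (- lor n b v) v"
  have "(lor n a' b')\<^sup>2 \<le> lor n a' a' * lor n b' b'"
    using assms by (intro lor_Cauchy_Schwarz_orthogonal[OF v]) (auto simp: a'_def b'_def)
  moreover have "lor n a' b' = lor n v v * (lor n a b * lor n v v - lor n a v * lor n b v)"
    by (simp add: a'_def b'_def lor_commute[of n v a] lor_commute[of n v b] algebra_simps)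
  moreover have "lor n a' a' = lor n v v * (lor n a a * lor n v v - (lor n a v)\<^sup>2)"
    by (simp add: a'_def lor_commute[of n v a] lor_commute[of n v b] algebra_simps power2_eq_square)
  moreover have "lor n b' b' = lor n v v * (lor n b b * lor n v v - (lor n b v)\<^sup>2)"
    by (simp add: b'_def lor_commute[of n v a] lor_commute[of n v b] algebra_simps power2_eq_square)
  ultimately have "(lor n v v)\<^sup>2 * (lor n a b * lor n v v - lor n a v * lor n b v)\<^sup>2
    \<le> (lor n v v)\<^sup>2 * ((lor n a a * lor n v v - (lor n a v)\<^sup>2) * (lor n b b * lor n v v - (lor n b v)\<^sup>2))"
    by (simp add: power_mult_distrib power2_eq_square mult_ac)
  thus ?thesis
    using v by (simp add: mult_le_cancel_left)
qed

text \<open>With \<open>- lor n x y\<close> read as cosh of a distance, this is the triangle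
  inequality in the form \<open>cosh (s + t) \<le> 2 * cosh s * cosh t\<close>, extended to
  unnormalised and light-like vectors.\<close>

lemma lor_le_twice_product:
  assumes y: "lor n y y = -1" "is_vec n y" and "lor n a a \<le> 0" "lor n b b \<le> 0" "is_vec n b"
  shows "\<bar>lor n a b\<bar> \<le> 2 * \<bar>lor n a y\<bar> * \<bar>lor n b y\<bar>"
proof -
  have r: "(lor n a b + lor n a y * lor n b y)\<^sup>2
      \<le> ((lor n a y)\<^sup>2 + lor n a a) * ((lor n b y)\<^sup>2 + lor n b b)"
    using lor_reverse_Cauchy_Schwarz[of n y b a] assms
    by (simp add: power2_eq_square algebra_simps)
  have nn: "0 \<le> (lor n b y)\<^sup>2 + lor n b b"
  proof -
    let ?c = "lc 1 b (lor n b y) y"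
    have "0 \<le> lor n ?c ?c"
      using y by (intro time_orthogonal_nonneg[of n y]) auto
    also have "lor n ?c ?c = (lor n b y)\<^sup>2 + lor n b b"
      using y by (simp add: lor_commute[of n y b] algebra_simps power2_eq_square)
    finally show ?thesis .
  qed
  note r
  also have "((lor n a y)\<^sup>2 + lor n a a) * ((lor n b y)\<^sup>2 + lor n b b)
      \<le> (lor n a y)\<^sup>2 * (lor n b y)\<^sup>2"
    using assms nn by (intro mult_mono) auto
  also have "\<dots> = (\<bar>lor n a y\<bar> * \<bar>lor n b y\<bar>)\<^sup>2"
    by (simp add: power_mult_distrib)
  finally have "\<bar>lor n a b + lor n a y * lor n b y\<bar> \<le> \<bar>lor n a y\<bar> * \<bar>lor n b y\<bar>"
    by (intro power2_le_iff_abs_le[THEN iffD1]) auto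
  thus ?thesis
    unfolding mult.assoc abs_mult[symmetric] by linarith
qed

text \<open>By strict Cauchy-Schwarz the time term decides the sign of the product.\<close>

lemma timelike_same_sheet:
  assumes "lor n x x < 0" "lor n y y < 0" "x (n+1) > 0"
  shows "lor n x y < 0 \<longleftrightarrow> y (n+1) > 0"
proof -
  let ?X = "\<Sum>i=1..n. (x i)\<^sup>2" and ?Y = "\<Sum>i=1..n. (y i)\<^sup>2"
  have X: "?X < (x (n+1))\<^sup>2" and Y: "?Y < (y (n+1))\<^sup>2"
    using assms by (simp_all add: lor_def power2_eq_square)
  have "(\<Sum>i=1..n. x i * y i)\<^sup>2 \<le> ?X * ?Y"
    by (rule Cauchy_Schwarz_ineq_sum)
  also have "\<dots> < (x (n+1))\<^sup>2 * (y (n+1))\<^sup>2"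
    using X Y by (intro mult_strict_mono') (auto intro: sum_nonneg)
  also have "\<dots> = (x (n+1) * y (n+1))\<^sup>2" by (simp add: power_mult_distrib)
  finally have c: "\<bar>\<Sum>i=1..n. x i * y i\<bar> < \<bar>x (n+1) * y (n+1)\<bar>"
    using abs_le_square_iff linorder_not_le by blast
  show ?thesis
  proof (cases "y (n+1) > 0")
    case True
    thus ?thesis using c assms by (simp add: lor_def abs_mult)
  next
    case False
    hence "x (n+1) * y (n+1) \<le> 0" using assms by (simp add: mult_le_0_iff)
    thus ?thesis using c False by (simp add: lor_def)
  qed
qed

section \<open>Lorentzian matrices\<close>

lemma is_vec_mat_vec [simp]: "is_vec n (mat_vec n A x)"
  by (simp add: is_vec_def mat_vec_def)

lemma is_mat_mat_mult [simp]: "is_mat n (mat_mult n A B)"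
  by (auto simp add: is_mat_def mat_mult_def)

lemma is_mat_idm [simp]: "is_mat n (idm n)"
  by (auto simp add: is_mat_def idm_def)

lemma mat_vec_lc [simp]: "mat_vec n A (lc a x b y) = lc a (mat_vec n A x) b (mat_vec n A y)"
  by (rule ext) (simp add: mat_vec_def lc_def sum.distrib sum_distrib_left algebra_simps)

lemma mat_vec_mat_mult [simp]: "mat_vec n (mat_mult n A B) x = mat_vec n A (mat_vec n B x)"
proof
  fix i
  show "mat_vec n (mat_mult n A B) x i = mat_vec n A (mat_vec n B x) i"
  proof (cases "i \<in> {1..n+1}")
    case True
    have "(\<Sum>j=1..n+1. (\<Sum>k=1..n+1. A i k * B k j) * x j)
        = (\<Sum>j=1..n+1. \<Sum>k=1..n+1. A i k * (B k j * x j))"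
      by (simp add: sum_distrib_right mult.assoc del: sum.cl_ivl_Suc)
    also have "\<dots> = (\<Sum>k=1..n+1. \<Sum>j=1..n+1. A i k * (B k j * x j))"
      by (rule sum.swap)
    also have "\<dots> = (\<Sum>k=1..n+1. A i k * (\<Sum>j=1..n+1. B k j * x j))"
      by (simp add: sum_distrib_left del: sum.cl_ivl_Suc)
    finally show ?thesis
      using True unfolding mat_vec_def mat_mult_def by (auto intro!: sum.cong simp del: sum.cl_ivl_Suc)
  next
    case False
    thus ?thesis unfolding mat_vec_def by (simp only: if_False)
  qed
qed

lemma mat_vec_idm [simp]:
  assumes "is_vec n x" shows "mat_vec n (idm n) x = x"
proof
  fix i
  show "mat_vec n (idm n) x i = x i"
  proof (cases "i \<in> {1..n+1}")
    case True
    have "(\<Sum>j=1..n+1. idm n i j * x j) = (\<Sum>j=1..n+1. if j = i then x j else 0)"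
      using True by (intro sum.cong) (auto simp: idm_def)
    also have "\<dots> = x i" using True by (subst sum.delta) auto
    finally show ?thesis using True by (simp add: mat_vec_def)
  next
    case False
    hence "x i = 0" using assms unfolding is_vec_def by blast
    thus ?thesis using False unfolding mat_vec_def by (simp only: if_False)
  qed
qed

lemma mat_vec_unit_vec:
  assumes "i \<in> {1..n+1}" "j \<in> {1..n+1}" shows "mat_vec n A (unit_vec j) i = A i j"
proof -
  have "(\<Sum>k=1..n+1. A i k * unit_vec j k) = (\<Sum>k=1..n+1. if k = j then A i k else 0)"
    by (intro sum.cong) (auto simp: unit_vec_def)
  also have "\<dots> = A i j" using assms by (subst sum.delta) auto
  finally show ?thesis using assms by (simp add: mat_vec_def)
qed

lemma is_vec_unit_vec [simp]: "j \<in> {1..n+1} \<Longrightarrow> is_vec n (unit_vec j)"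
  by (auto simp: is_vec_def unit_vec_def)

lemma mat_eqI:
  assumes "is_mat n A" "is_mat n B" "\<And>x. is_vec n x \<Longrightarrow> mat_vec n A x = mat_vec n B x"
  shows "A = B"
proof (intro ext)
  fix i j
  show "A i j = B i j"
  proof (cases "i \<in> {1..n+1} \<and> j \<in> {1..n+1}")
    case True
    hence "is_vec n (unit_vec j)" by (intro is_vec_unit_vec) blast
    from fun_cong[OF assms(3)[OF this], of i] show ?thesis
      using True by (simp only: mat_vec_unit_vec)
  next
    case False
    hence "A i j = 0" "B i j = 0" using assms(1,2) unfolding is_mat_def by blast+
    thus ?thesis by simp
  qed
qed

text \<open>Transported from \<open>mat_mult_left_right_inverse\<close>; the map \<open>M\<close>
  shifts the indices by one, since \<open>mat\<close> counts from 0.\<close>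

lemma mat_mult_left_right_inverse_fun:
  assumes "mat_mult n A B = idm n"
  shows "mat_mult n B A = idm n"
proof -
  define M where "M X = mat (n+1) (n+1) (\<lambda>(i,j). X (Suc i) (Suc j))" for X :: "nat \<Rightarrow> nat \<Rightarrow> real"
  have MM: "M X * M Y = M (mat_mult n X Y)" for X Y
  proof (rule eq_matI)
    fix i j assume "i < dim_row (M (mat_mult n X Y))" "j < dim_col (M (mat_mult n X Y))"
    hence ij: "i < n+1" "j < n+1" by (simp_all add: M_def)
    have "(M X * M Y) $$ (i,j) = (\<Sum>k = 0..<n+1. X (Suc i) (Suc k) * Y (Suc k) (Suc j))"
      using ij by (simp add: M_def scalar_prod_def del: sum.op_ivl_Suc)
    also have "\<dots> = (\<Sum>k = 1..n+1. X (Suc i) k * Y k (Suc j))"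
      using sum.shift_bounds_Suc_ivl[of "\<lambda>k. X (Suc i) k * Y k (Suc j)" 0 "n+1"]
      by (simp only: One_nat_def Suc_eq_plus1[symmetric] atLeastLessThanSuc_atLeastAtMost)
    also have "\<dots> = M (mat_mult n X Y) $$ (i,j)"
      using ij by (simp add: M_def mat_mult_def del: sum.cl_ivl_Suc)
    finally show "(M X * M Y) $$ (i,j) = M (mat_mult n X Y) $$ (i,j)" .
  qed (simp_all add: M_def)
  have MI: "M (idm n) = 1\<^sub>m (n+1)"
    by (rule eq_matI) (auto simp: M_def idm_def)
  have car: "M X \<in> carrier_mat (n+1) (n+1)" for X
    by (simp add: M_def)
  have "M A * M B = 1\<^sub>m (n+1)"
    unfolding MM assms MI ..
  from mat_mult_left_right_inverse[OF car car this] have "M B * M A = 1\<^sub>m (n+1)" .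
  hence *: "M (mat_mult n B A) = M (idm n)" unfolding MM MI .
  show ?thesis
  proof (intro ext)
    fix i j
    show "mat_mult n B A i j = idm n i j"
    proof (cases "i \<in> {1..n+1} \<and> j \<in> {1..n+1}")
      case True
      hence "i - 1 < n+1" "j - 1 < n+1" "Suc (i - 1) = i" "Suc (j - 1) = j"
        by auto
      hence entry: "M X $$ (i - 1, j - 1) = X i j" for X
        unfolding M_def by (simp only: index_mat split_conv)
      have "mat_mult n B A i j = M (mat_mult n B A) $$ (i - 1, j - 1)"
        by (rule entry[symmetric])
      also have "\<dots> = M (idm n) $$ (i - 1, j - 1)"
        by (rule arg_cong[OF *])
      also have "\<dots> = idm n i j"
        by (rule entry)
      finally show ?thesis .
    next
      case False
      thus ?thesis
        using is_mat_mat_mult[of n B A] is_mat_idm[of n] unfolding is_mat_def by metis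
    qed
  qed
qed

section \<open>Adjoints and inverses of Lorentzian matrices\<close>

definition time_sign :: "nat \<Rightarrow> nat \<Rightarrow> real" where
  "time_sign n i = (if i = n+1 then -1 else 1)"

text \<open>With J the diagonal matrix of \<open>time_sign\<close>, this is J A^T J, the adjoint
  with respect to \<open>lor\<close>; for Lorentzian \<open>A\<close> it is the inverse.\<close>

definition adj :: "nat \<Rightarrow> (nat \<Rightarrow> nat \<Rightarrow> real) \<Rightarrow> nat \<Rightarrow> nat \<Rightarrow> real" where
  "adj n A = (\<lambda>i j. time_sign n i * time_sign n j * A j i)"

lemma time_sign_square [simp]: "time_sign n i * time_sign n i = 1"
  "time_sign n i * (time_sign n i * r) = r"
  by (simp_all add: time_sign_def)

lemma lor_eq_sum: "lor n x y = (\<Sum>i=1..n+1. time_sign n i * x i * y i)"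
proof -
  have "(\<Sum>i=1..n. time_sign n i * x i * y i) = (\<Sum>i=1..n. x i * y i)"
    by (intro sum.cong) (auto simp: time_sign_def)
  thus ?thesis by (simp add: lor_def time_sign_def)
qed

lemma lor_unit_vec:
  assumes "i \<in> {1..n+1}" shows "lor n a (unit_vec i) = time_sign n i * a i"
proof -
  have "lor n a (unit_vec i) = (\<Sum>j=1..n+1. if j = i then time_sign n i * a i else 0)"
    unfolding lor_eq_sum by (intro sum.cong) (auto simp: unit_vec_def)
  also have "\<dots> = time_sign n i * a i" using assms by (subst sum.delta) auto
  finally show ?thesis .
qed

lemma vec_eqI:
  assumes "is_vec n a" "is_vec n b" "\<And>y. is_vec n y \<Longrightarrow> lor n a y = lor n b y"
  shows "a = b"
proof
  fix i
  show "a i = b i"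
  proof (cases "i \<in> {1..n+1}")
    case True
    from assms(3)[OF is_vec_unit_vec[OF True]] show ?thesis
      unfolding lor_unit_vec[OF True] by (auto simp: time_sign_def split: if_splits)
  next
    case False
    hence "a i = 0" "b i = 0" using assms(1,2) unfolding is_vec_def by blast+
    thus ?thesis by simp
  qed
qed

lemma is_mat_adj: "is_mat n A \<Longrightarrow> is_mat n (adj n A)"
  unfolding is_mat_def adj_def by (metis mult_zero_right)

lemma lor_mat_vec_left: "lor n (mat_vec n A x) y = lor n x (mat_vec n (adj n A) y)"
proof -
  have "lor n (mat_vec n A x) y
      = (\<Sum>i=1..n+1. \<Sum>j=1..n+1. time_sign n i * A i j * x j * y i)"
    unfolding lor_eq_sum mat_vec_def
    by (intro sum.cong) (auto simp: sum_distrib_left sum_distrib_right mult_ac simp del: sum.cl_ivl_Suc)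
  also have "\<dots> = (\<Sum>j=1..n+1. \<Sum>i=1..n+1. time_sign n i * A i j * x j * y i)"
    by (rule sum.swap)
  also have "\<dots> = lor n x (mat_vec n (adj n A) y)"
    unfolding lor_eq_sum mat_vec_def adj_def
    by (intro sum.cong) (auto simp: sum_distrib_left sum_distrib_right mult_ac simp del: sum.cl_ivl_Suc)
  finally show ?thesis .
qed

lemma lor_mat_vec_right: "lor n x (mat_vec n A y) = lor n (mat_vec n (adj n A) x) y"
  by (metis lor_commute lor_mat_vec_left)

lemma lorentzian_lor:
  "lorentzian n A \<Longrightarrow> is_vec n x \<Longrightarrow> is_vec n y \<Longrightarrow> lor n (mat_vec n A x) (mat_vec n A y) = lor n x y"
  by (simp add: lorentzian_def)

lemma adj_mult_lorentzian:
  assumes "lorentzian n A" shows "mat_mult n (adj n A) A = idm n"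
proof (rule mat_eqI)
  fix x assume x: "is_vec n x"
  have "mat_vec n (adj n A) (mat_vec n A x) = x"
    by (rule vec_eqI) (use assms x in \<open>auto simp: lor_mat_vec_right[symmetric] lorentzian_lor\<close>)
  thus "mat_vec n (mat_mult n (adj n A) A) x = mat_vec n (idm n) x"
    using x by simp
qed auto

lemma mult_adj_lorentzian:
  assumes "lorentzian n A" shows "mat_mult n A (adj n A) = idm n"
  by (rule mat_mult_left_right_inverse_fun[OF adj_mult_lorentzian[OF assms]])

lemma mat_vec_adj_cancel [simp]:
  assumes "lorentzian n A" "is_vec n x"
  shows "mat_vec n (adj n A) (mat_vec n A x) = x" "mat_vec n A (mat_vec n (adj n A) x) = x"
  using adj_mult_lorentzian[OF assms(1)] mult_adj_lorentzian[OF assms(1)] assms(2)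
  by (metis mat_vec_idm mat_vec_mat_mult)+

lemma lorentzian_adj:
  assumes "lorentzian n A" shows "lorentzian n (adj n A)"
  using assms unfolding lorentzian_def
  by (metis (full_types) assms is_mat_adj is_vec_mat_vec mat_vec_adj_cancel(2))

lemma lorentzian_mult: "lorentzian n A \<Longrightarrow> lorentzian n B \<Longrightarrow> lorentzian n (mat_mult n A B)"
  by (simp add: lorentzian_def)

lemma lorentzian_idm: "lorentzian n (idm n)"
  by (simp add: lorentzian_def)

text \<open>Serves the rule \<open>gen_inv\<close>, where an inverse is only given as a right
  inverse.\<close>

lemma right_inverse_eq_adj:
  assumes "lorentzian n A" "is_mat n B" "mat_mult n A B = idm n"
  shows "B = adj n A"
proof (rule mat_eqI)
  fix x assume x: "is_vec n x"
  have "mat_vec n A (mat_vec n B x) = x"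
    using assms(3) x by (metis mat_vec_idm mat_vec_mat_mult)
  thus "mat_vec n B x = mat_vec n (adj n A) x"
    using mat_vec_adj_cancel(1)[OF assms(1), of "mat_vec n B x"] by simp
qed (use assms in \<open>auto simp: is_mat_adj lorentzian_def\<close>)

section \<open>Reflections\<close>

definition refl_vec :: "nat \<Rightarrow> real \<Rightarrow> (nat \<Rightarrow> real) \<Rightarrow> (nat \<Rightarrow> real) \<Rightarrow> nat \<Rightarrow> real" where
  "refl_vec n c w x = lc 1 x (- (c * lor n x w)) w"

lemma is_mat_lin_refl [simp]: "is_mat n (lin_refl n c w)"
  by (auto simp: is_mat_def lin_refl_def)

lemma mat_vec_lin_refl:
  assumes "is_vec n w" "is_vec n x"
  shows "mat_vec n (lin_refl n c w) x = refl_vec n c w x"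
proof
  fix i
  show "mat_vec n (lin_refl n c w) x i = refl_vec n c w x i"
  proof (cases "i \<in> {1..n+1}")
    case True
    have "mat_vec n (lin_refl n c w) x i
        = (\<Sum>j=1..n+1. idm n i j * x j - c * w i * (time_sign n j * x j * w j))"
      unfolding mat_vec_def lin_refl_def if_P[OF True]
      by (intro sum.cong) (use True in \<open>auto simp: time_sign_def algebra_simps\<close>)
    also have "\<dots> = (\<Sum>j=1..n+1. idm n i j * x j) - c * w i * lor n x w"
      unfolding lor_eq_sum sum_subtractf sum_distrib_left ..
    also have "(\<Sum>j=1..n+1. idm n i j * x j) = mat_vec n (idm n) x i"
      unfolding mat_vec_def if_P[OF True] ..
    also have "\<dots> = x i" using assms by simp
    finally show ?thesis by (simp add: refl_vec_def lc_def)
  next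
    case False
    hence "w i = 0" "x i = 0" using assms unfolding is_vec_def by blast+
    moreover have "mat_vec n (lin_refl n c w) x i = 0"
      using False unfolding mat_vec_def by (rule if_not_P)
    ultimately show ?thesis by (simp add: refl_vec_def lc_def)
  qed
qed

text \<open>The hypothesis on \<open>c\<close> covers both kinds of mirrors: roots of norm 2 with
  \<open>c = 1\<close>, and unit vectors with \<open>c = 2\<close>.\<close>

lemma lor_refl_vec:
  assumes "c * lor n w w = 2"
  shows "lor n (refl_vec n c w x) (refl_vec n c w y) = lor n x y"
proof -
  have "lor n (refl_vec n c w x) (refl_vec n c w y)
      = lor n x y - 2 * c * lor n x w * lor n y w + c * (c * lor n w w) * lor n x w * lor n y w"
    by (simp add: refl_vec_def lor_commute[of n w y] algebra_simps)
  thus ?thesis by (simp add: assms)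
qed

lemma refl_vec_refl_vec:
  assumes "c * lor n w w = 2" shows "refl_vec n c w (refl_vec n c w x) = x"
proof
  fix i
  have "lor n (refl_vec n c w x) w = lor n x w - c * lor n w w * lor n x w"
    by (simp add: refl_vec_def)
  hence "lor n (refl_vec n c w x) w = - lor n x w"
    by (simp add: assms)
  thus "refl_vec n c w (refl_vec n c w x) i = x i"
    unfolding refl_vec_def[of n c w "refl_vec n c w x"] by (simp add: refl_vec_def lc_def)
qed

lemma lorentzian_lin_refl:
  "is_vec n w \<Longrightarrow> c * lor n w w = 2 \<Longrightarrow> lorentzian n (lin_refl n c w)"
  by (simp add: lorentzian_def mat_vec_lin_refl lor_refl_vec)

section \<open>Preservation of the time direction\<close>

lemma positive_lorentzianI:
  assumes "lorentzian n A"
    and "\<And>x. is_vec n x \<Longrightarrow> lor n x x < 0 \<Longrightarrow> x (n+1) > 0 \<Longrightarrow> mat_vec n A x (n+1) > 0"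
  shows "positive_lorentzian n A"
  unfolding positive_lorentzian_def
proof (intro conjI allI impI)
  fix x assume x: "is_vec n x" "lor n x x < 0"
  have "x (n+1) \<noteq> 0"
  proof
    assume "x (n+1) = 0"
    hence "lor n x x = (\<Sum>i=1..n. x i * x i)" by (simp add: lor_def)
    moreover have "\<dots> \<ge> 0" by (intro sum_nonneg) simp
    ultimately show False using x(2) by linarith
  qed
  then consider "x (n+1) > 0" | "x (n+1) < 0" by linarith
  thus "sgn (mat_vec n A x (n+1)) = sgn (x (n+1))"
  proof cases
    case 1
    thus ?thesis using assms(2)[OF x] by (simp add: sgn_if)
  next
    case 2
    \<comment> \<open>This is \<open>- x\<close>, which reduces the past case to the future
      one.\<close>
    let ?y = "lc (-1) x 0 x"
    have "mat_vec n A ?y (n+1) > 0"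
      using x 2 by (intro assms(2)) (simp, simp, simp add: lc_def)
    hence "mat_vec n A x (n+1) < 0" unfolding mat_vec_lc by (simp add: lc_def)
    thus ?thesis using 2 by (simp add: sgn_if)
  qed
qed (rule assms(1))

lemma positive_lorentzian_timelike:
  assumes "positive_lorentzian n A" "is_vec n x" "lor n x x < 0" "x (n+1) > 0"
  shows "mat_vec n A x (n+1) > 0"
proof -
  have "sgn (mat_vec n A x (n+1)) = sgn (x (n+1))"
    using assms by (simp add: positive_lorentzian_def)
  thus ?thesis using assms(4) by (simp add: sgn_if split: if_splits)
qed

text \<open>A time-like \<open>x\<close> and its mirror image have product
  \<open><x,x> - c * <x,w>^2 < 0\<close>, so they lie on the same sheet.\<close>

lemma positive_lorentzian_lin_refl:
  assumes w: "is_vec n w" "c * lor n w w = 2" "c > 0"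
  shows "positive_lorentzian n (lin_refl n c w)"
proof (rule positive_lorentzianI)
  fix x assume x: "is_vec n x" "lor n x x < 0" "x (n+1) > 0"
  have "lor n (refl_vec n c w x) (refl_vec n c w x) < 0"
    using x by (simp add: lor_refl_vec w)
  moreover have "lor n x (refl_vec n c w x) = lor n x x - c * (lor n x w)\<^sup>2"
    by (simp add: refl_vec_def power2_eq_square)
  hence "lor n x (refl_vec n c w x) < 0"
    using x(2) w(3) by (smt (verit) zero_le_mult_iff zero_le_power2)
  ultimately show "mat_vec n (lin_refl n c w) x (n+1) > 0"
    using timelike_same_sheet[of n x "refl_vec n c w x"] x w
    by (simp add: mat_vec_lin_refl)
qed (use w in \<open>auto intro: lorentzian_lin_refl\<close>)

section \<open>Integral vectors and matrices\<close>

definition int_vec :: "nat \<Rightarrow> (nat \<Rightarrow> real) \<Rightarrow> bool" where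
  "int_vec n x \<longleftrightarrow> is_vec n x \<and> (\<forall>i. x i \<in> \<int>)"

lemma int_vec_is_vec [simp]: "int_vec n x \<Longrightarrow> is_vec n x"
  by (simp add: int_vec_def)

lemma int_vec_lc [intro]:
  "int_vec n x \<Longrightarrow> int_vec n y \<Longrightarrow> a \<in> \<int> \<Longrightarrow> b \<in> \<int> \<Longrightarrow> int_vec n (lc a x b y)"
  by (auto simp: int_vec_def lc_def is_vec_def)

lemma lor_Ints [intro]: "int_vec n x \<Longrightarrow> int_vec n y \<Longrightarrow> lor n x y \<in> \<int>"
  unfolding lor_def int_vec_def by (intro Ints_diff Ints_sum Ints_mult) auto

lemma int_vec_unit_vec [intro]: "i \<in> {1..n+1} \<Longrightarrow> int_vec n (unit_vec i)"
  by (simp add: int_vec_def) (simp add: unit_vec_def)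

lemma Gamma_int_vec [intro]:
  assumes "A \<in> Gamma n" "int_vec n x" shows "int_vec n (mat_vec n A x)"
proof -
  have "(\<Sum>j=1..n+1. A i j * x j) \<in> \<int>" for i
    using assms by (intro Ints_sum Ints_mult) (simp_all add: Gamma_def int_vec_def)
  hence "mat_vec n A x i \<in> \<int>" for i
    unfolding mat_vec_def by (cases "i \<in> {1..n+1}") (simp_all only: if_True if_False Ints_0)
  thus ?thesis by (simp add: int_vec_def)
qed

section \<open>The integral group and its congruence subgroup\<close>

lemma Gamma_positive: "A \<in> Gamma n \<Longrightarrow> positive_lorentzian n A"
  and Gamma_lorentzian [simp]: "A \<in> Gamma n \<Longrightarrow> lorentzian n A"
  and Gamma2_Gamma [simp]: "B \<in> Gamma2 n \<Longrightarrow> B \<in> Gamma n"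
  by (simp_all add: Gamma_def Gamma2_def positive_lorentzian_def)

lemma Gamma_idm: "idm n \<in> Gamma n"
  unfolding Gamma_def using lorentzian_idm by (auto intro!: positive_lorentzianI) (simp add: idm_def)

lemma Gamma_mult:
  assumes "A \<in> Gamma n" "B \<in> Gamma n" shows "mat_mult n A B \<in> Gamma n"
proof -
  have "positive_lorentzian n (mat_mult n A B)"
  proof (rule positive_lorentzianI)
    fix x assume "is_vec n x" "lor n x x < 0" "x (n+1) > 0"
    hence "mat_vec n A (mat_vec n B x) (n+1) > 0"
      using assms Gamma_positive
      by (intro positive_lorentzian_timelike) (auto simp: lorentzian_lor)
    thus "mat_vec n (mat_mult n A B) x (n+1) > 0" by simp
  qed (use assms in \<open>simp add: lorentzian_mult\<close>)
  moreover have "mat_mult n A B i j \<in> \<int>" for i j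
  proof -
    have "(\<Sum>k=1..n+1. A i k * B k j) \<in> \<int>"
      using assms by (intro Ints_sum Ints_mult) (simp_all add: Gamma_def)
    thus ?thesis
      unfolding mat_mult_def
      by (cases "i \<in> {1..n+1} \<and> j \<in> {1..n+1}") (simp_all only: simp_thms if_True if_False Ints_0)
  qed
  ultimately show ?thesis by (simp add: Gamma_def)
qed

lemma Gamma_adj:
  assumes "A \<in> Gamma n" shows "adj n A \<in> Gamma n"
proof -
  have "positive_lorentzian n (adj n A)"
  proof (rule positive_lorentzianI)
    fix x assume x: "is_vec n x" "lor n x x < 0" "x (n+1) > 0"
    let ?y = "mat_vec n (adj n A) x"
    have "lor n ?y ?y < 0"
      using x assms by (simp add: lorentzian_lor lorentzian_adj)
    hence "sgn (mat_vec n A ?y (n+1)) = sgn (?y (n+1))"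
      using Gamma_positive[OF assms] unfolding positive_lorentzian_def
      by (metis is_vec_mat_vec)
    thus "?y (n+1) > 0"
      using x assms by (simp add: sgn_if split: if_splits)
  qed (use assms in \<open>simp add: lorentzian_adj\<close>)
  moreover have "adj n A i j \<in> \<int>" for i j
  proof -
    have "A j i \<in> \<int>" using assms by (simp add: Gamma_def)
    thus ?thesis by (simp add: adj_def time_sign_def)
  qed
  ultimately show ?thesis by (simp add: Gamma_def)
qed

text \<open>Together with \<open>Gamma2I\<close> this trades congruence of entries for congruence of
  \<open>A x\<close> with \<open>x\<close> on integral vectors, a form that passes at once to
  products and inverses.\<close>

lemma Gamma2_congruent:
  assumes A: "A \<in> Gamma2 n" and x: "int_vec n x"
  shows "(mat_vec n A x i - x i) / 2 \<in> \<int>"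
proof (cases "i \<in> {1..n+1}")
  case True
  have "(A i j - idm n i j) / 2 \<in> \<int>" if "j \<in> {1..n+1}" for j
  proof -
    from A have "\<forall>i\<in>{1..n+1}. \<forall>j\<in>{1..n+1}. \<exists>k::int. A i j - idm n i j = 2 * of_int k"
      unfolding Gamma2_def mem_Collect_eq by (rule conjunct2)
    from bspec[OF bspec[OF this True] that]
    obtain k :: int where "A i j - idm n i j = 2 * of_int k" ..
    thus ?thesis by simp
  qed
  hence "(\<Sum>j=1..n+1. (A i j - idm n i j) / 2 * x j) \<in> \<int>"
    using x by (intro Ints_sum Ints_mult) (simp_all only: int_vec_def)
  also have "(\<Sum>j=1..n+1. (A i j - idm n i j) / 2 * x j)
      = (mat_vec n A x i - mat_vec n (idm n) x i) / 2"
    unfolding mat_vec_def if_P[OF True] sum_subtractf[symmetric] sum_divide_distrib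
    by (intro sum.cong) (auto simp: algebra_simps)
  finally show ?thesis using x by simp
next
  case False
  hence "x i = 0" "mat_vec n A x i = 0"
    using is_vec_mat_vec[of n A x] int_vec_is_vec[OF x] unfolding is_vec_def by blast+
  thus ?thesis by simp
qed

lemma Gamma2I:
  assumes A: "A \<in> Gamma n" "\<And>x i. int_vec n x \<Longrightarrow> (mat_vec n A x i - x i) / 2 \<in> \<int>"
  shows "A \<in> Gamma2 n"
proof -
  have "\<exists>k::int. A i j - idm n i j = 2 * of_int k" if "i \<in> {1..n+1}" "j \<in> {1..n+1}" for i j
  proof -
    have "(mat_vec n A (unit_vec j) i - unit_vec j i) / 2 \<in> \<int>"
      using A(2) int_vec_unit_vec[OF that(2)] .
    hence "(A i j - idm n i j) / 2 \<in> \<int>"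
      using that(1) unfolding mat_vec_unit_vec[OF that] by (simp add: idm_def unit_vec_def eq_commute)
    then obtain k :: int where "(A i j - idm n i j) / 2 = of_int k" by (rule Ints_cases)
    thus ?thesis by (intro exI[of _ k]) simp
  qed
  thus ?thesis
    unfolding Gamma2_def by (intro CollectI conjI ballI A(1))
qed


lemma Gamma2_idm: "idm n \<in> Gamma2 n"
  by (intro Gamma2I Gamma_idm) simp

lemma Gamma2_mult:
  assumes "A \<in> Gamma2 n" "B \<in> Gamma2 n" shows "mat_mult n A B \<in> Gamma2 n"
proof (rule Gamma2I)
  fix x i assume x: "int_vec n x"
  have "(mat_vec n A (mat_vec n B x) i - mat_vec n B x i) / 2 + (mat_vec n B x i - x i) / 2 \<in> \<int>"
    using assms x Gamma_int_vec[of B n x] by (intro Ints_add Gamma2_congruent) auto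
  thus "(mat_vec n (mat_mult n A B) x i - x i) / 2 \<in> \<int>"
    by (simp add: add_divide_distrib[symmetric])
qed (use assms in \<open>simp add: Gamma_mult\<close>)

lemma Gamma2_adj:
  assumes "A \<in> Gamma2 n" shows "adj n A \<in> Gamma2 n"
proof (rule Gamma2I)
  fix x i assume x: "int_vec n x"
  have "int_vec n (mat_vec n (adj n A) x)"
    using assms x by (intro Gamma_int_vec Gamma_adj) auto
  hence "(mat_vec n A (mat_vec n (adj n A) x) i - mat_vec n (adj n A) x i) / 2 \<in> \<int>"
    using assms by (intro Gamma2_congruent)
  hence "- ((x i - mat_vec n (adj n A) x i) / 2) \<in> \<int>"
    using assms x by simp
  thus "(mat_vec n (adj n A) x i - x i) / 2 \<in> \<int>"
    by (simp add: minus_divide_left)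
qed (use assms in \<open>simp add: Gamma_adj\<close>)

text \<open>Right inverses of Lorentzian matrices coincide with \<open>adj\<close>, so closure under
  \<open>adj\<close> accounts for the rule \<open>gen_inv\<close>.\<close>

lemma gen_grp_subset:
  assumes "S \<subseteq> G" "idm n \<in> G" "\<And>A B. A \<in> G \<Longrightarrow> B \<in> G \<Longrightarrow> mat_mult n A B \<in> G"
    "\<And>A. A \<in> G \<Longrightarrow> lorentzian n A" "\<And>A. A \<in> G \<Longrightarrow> adj n A \<in> G"
  shows "gen_grp n S \<subseteq> G"
proof
  fix A assume "A \<in> gen_grp n S"
  thus "A \<in> G"
  proof induction
    case gen_id
    show ?case by (rule assms(2))
  next
    case (gen_gen s)
    thus ?case using assms(1) by (rule subsetD[rotated])
  next
    case (gen_mult a b)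
    show ?case by (rule assms(3)) fact+
  next
    case (gen_inv a b)
    have "b = adj n a"
      by (rule right_inverse_eq_adj) (rule assms(4), fact+)
    moreover have "adj n a \<in> G" by (rule assms(5)) fact
    ultimately show ?case by (simp only:)
  qed
qed

lemma gen_grp_adj:
  assumes "A \<in> gen_grp n S" "lorentzian n A" shows "adj n A \<in> gen_grp n S"
  by (rule gen_inv[OF assms(1) is_mat_adj mult_adj_lorentzian[OF assms(2)]])
    (use assms(2) in \<open>simp only: lorentzian_def\<close>)

lemma hyp_mat_vec:
  assumes "A \<in> Gamma n" "x \<in> hyp n" shows "mat_vec n A x \<in> hyp n"
  using assms positive_lorentzian_timelike[OF Gamma_positive]
  by (auto simp: hyp_def lorentzian_lor)

lemma Gamma_lin_refl:
  assumes "int_vec n w" "c * lor n w w = 2" "c > 0" "c \<in> \<int>"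
  shows "lin_refl n c w \<in> Gamma n"
  using assms positive_lorentzian_lin_refl[of n w c]
  by (auto simp: Gamma_def lin_refl_def idm_def int_vec_def intro!: Ints_diff Ints_mult)

lemma Gamma2_lin_refl:
  assumes "int_vec n w" "lor n w w = 1"
  shows "lin_refl n 2 w \<in> Gamma2 n"
proof (rule Gamma2I)
  fix x i assume x: "int_vec n x"
  have "- (lor n x w * w i) \<in> \<int>"
    using assms x by (intro Ints_minus Ints_mult) (auto simp: int_vec_def intro: lor_Ints)
  thus "(mat_vec n (lin_refl n 2 w) x i - x i) / 2 \<in> \<int>"
    using assms x by (simp add: mat_vec_lin_refl refl_vec_def lc_def)
qed (use assms in \<open>intro Gamma_lin_refl, auto\<close>)

section \<open>The characteristic vector and the exceptional vectors\<close>

definition kappa :: "nat \<Rightarrow> nat \<Rightarrow> real" where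
  "kappa n = (\<lambda>i. if i \<in> {1..n} then 1 else if i = n+1 then 3 else 0)"

definition exceptional :: "nat \<Rightarrow> (nat \<Rightarrow> real) set" where
  "exceptional n = {e. int_vec n e \<and> lor n e e = 1 \<and> lor n e (kappa n) = -1}"

text \<open>For \<open>2 \<le> n \<le> 7\<close> this is the nef cone of the del Pezzo surface:
  \<open>lor\<close> is minus the intersection form and \<open>kappa\<close> the anticanonical
  class.\<close>

definition nef :: "nat \<Rightarrow> (nat \<Rightarrow> real) set" where
  "nef n = {x. is_vec n x \<and> (\<forall>e\<in>exceptional n. lor n x e \<le> 0)}"

lemma Ints_less_imp_add1_le:
  fixes a b :: real assumes "a \<in> \<int>" "b \<in> \<int>" "a < b" shows "a + 1 \<le> b"
proof -
  obtain k m where km: "a = of_int k" "b = of_int m"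
    using assms(1,2) by (elim Ints_cases)
  hence "k + 1 \<le> m" using assms(3) by simp
  hence "of_int (k + 1) \<le> (of_int m :: real)" by (simp only: of_int_le_iff)
  thus ?thesis by (simp add: km)
qed

lemma Ints_half_square_diff:
  fixes x :: real assumes "x \<in> \<int>" shows "(x * x - x) / 2 \<in> \<int>"
proof -
  obtain k where k: "x = of_int k" using assms by (rule Ints_cases)
  have "even (k * k - k)" by auto
  then obtain m where "k * k - k = 2 * m" by (rule dvdE)
  hence "(x * x - x) / 2 = of_int m"
    unfolding k by (metis (no_types, lifting) nonzero_mult_div_cancel_left of_int_diff of_int_mult of_int_numeral zero_neq_numeral)
  thus ?thesis by simp
qed

lemma int_vec_kappa [simp, intro]: "int_vec n (kappa n)"
  by (auto simp: int_vec_def is_vec_def kappa_def)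

lemma is_vec_kappa [simp]: "is_vec n (kappa n)"
  by (rule int_vec_is_vec) (rule int_vec_kappa)

lemma kappa_time [simp]: "kappa n (n+1) = 3" "kappa n (Suc n) = 3"
  by (simp_all add: kappa_def)

lemma lor_kappa: "lor n x (kappa n) = (\<Sum>i=1..n. x i) - 3 * x (n+1)"
proof -
  have "(\<Sum>i=1..n. x i * kappa n i) = (\<Sum>i=1..n. x i)"
    by (intro sum.cong) (auto simp: kappa_def)
  thus ?thesis by (simp add: lor_def)
qed

lemma lor_kappa_kappa [simp]: "lor n (kappa n) (kappa n) = real n - 9"
proof -
  have "(\<Sum>i=1..n. kappa n i) = (\<Sum>i=1..n. 1)"
    by (intro sum.cong) (auto simp: kappa_def)
  thus ?thesis by (simp add: lor_kappa)
qed

text \<open>Each coordinate contributes an even \<open>x * x - x\<close>; as the time coordinate of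
  \<open>kappa\<close> is 3 and not 1, twice the time coordinate of \<open>u\<close> is left
  over.\<close>

lemma kappa_characteristic:
  assumes "int_vec n u" shows "(lor n u u - lor n u (kappa n)) / 2 \<in> \<int>"
proof -
  have I: "u i \<in> \<int>" for i using assms by (simp add: int_vec_def)
  have "(\<Sum>i=1..n. (u i * u i - u i) / 2) - (u (n+1) * u (n+1) - u (n+1)) / 2 + u (n+1) \<in> \<int>"
    by (intro Ints_add Ints_diff Ints_sum Ints_half_square_diff I)
  also have "(\<Sum>i=1..n. (u i * u i - u i) / 2) - (u (n+1) * u (n+1) - u (n+1)) / 2 + u (n+1)
     = (lor n u u - lor n u (kappa n)) / 2"
    unfolding lor_kappa sum_divide_distrib[symmetric] sum_subtractf lor_def[of n u u]
    by (simp add: field_simps)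
  finally show ?thesis .
qed

text \<open>Cauchy-Schwarz against the all-ones vector. The point is that 7 is smaller than 9, the
  square of the time coordinate of \<open>kappa\<close>.\<close>

lemma sum_square_le:
  fixes u :: "nat \<Rightarrow> real" assumes "n \<le> 7"
  shows "(\<Sum>i=1..n. u i)\<^sup>2 \<le> 7 * (\<Sum>i=1..n. u i * u i)"
proof -
  have "(\<Sum>i=1..n. u i * 1)\<^sup>2 \<le> (\<Sum>i=1..n. (u i)\<^sup>2) * (\<Sum>i=1..n. 1\<^sup>2)"
    by (rule Cauchy_Schwarz_ineq_sum)
  also have "\<dots> \<le> (\<Sum>i=1..n. (u i)\<^sup>2) * 7"
    using assms by (intro mult_left_mono sum_nonneg) auto
  finally show ?thesis by (simp add: power2_eq_square mult.commute)
qed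

text \<open>Since \<open>kappa\<close> is time-like, bounds on the norm and on the product with
  \<open>kappa\<close> confine a vector to a bounded box.\<close>

lemma finite_bounded_int_vecs:
  assumes "n \<le> 7"
  shows "finite {u. int_vec n u \<and> lor n u u \<le> K \<and> \<bar>lor n u (kappa n)\<bar> \<le> C}"
proof -
  define C' K' where "C' = \<bar>C\<bar>" and "K' = \<bar>K\<bar>"
  \<comment> \<open>If the absolute time coordinate \<open>t\<close> exceeded \<open>M\<close>, then
    \<open>t * t \<ge> M * t\<close> would contradict
    \<open>(3 * t - C')^2 \<le> 7 * (t * t) + 7 * K'\<close>. \<open>L\<close> then bounds every
    coordinate through \<open>sq\<close>.\<close>
  define M where "M = 3 * C' + 7 * K' + 1"
  define L where "L = M * M + K' + 1"
  have nn: "C' \<ge> 0" "K' \<ge> 0" "M \<ge> 1" by (simp_all add: C'_def K'_def M_def)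
  have bound: "\<bar>u i\<bar> \<le> L"
    if u: "int_vec n u" "lor n u u \<le> K" "\<bar>lor n u (kappa n)\<bar> \<le> C" and i: "i \<in> {1..n+1}" for u i
  proof -
    define t S T where "t = \<bar>u (n+1)\<bar>" and "S = (\<Sum>i=1..n. u i)" and "T = (\<Sum>i=1..n. u i * u i)"
    have T: "T \<le> t * t + K'" using u(2) by (simp add: lor_def K'_def T_def t_def)
    have S: "3 * t - C' \<le> \<bar>S\<bar>" using u(3) unfolding lor_kappa C'_def S_def t_def by linarith
    have S2: "S\<^sup>2 \<le> 7 * (t * t) + 7 * K'"
      using sum_square_le[OF assms, of u] T unfolding S_def[symmetric] T_def[symmetric] by linarith
    have t: "t \<le> M"
    proof (rule ccontr)
      assume "\<not> t \<le> M"
      hence tM: "t > M" by simp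
      have "0 \<le> 3 * t - C'" using tM nn unfolding M_def by linarith
      hence "(3 * t - C')\<^sup>2 \<le> \<bar>S\<bar>\<^sup>2" using S by (intro power_mono)
      hence "(3 * t - C')\<^sup>2 \<le> 7 * (t * t) + 7 * K'" using S2 by simp
      hence "2 * (t * t) + C' * C' \<le> 6 * C' * t + 7 * K'"
        by (simp add: power2_eq_square algebra_simps)
      moreover have "M * t \<le> t * t" using tM t_def by (intro mult_right_mono) auto
      moreover have "M * t = 3 * C' * t + 7 * K' * t + t"
        by (simp add: M_def algebra_simps)
      moreover have "7 * K' * 1 \<le> 7 * K' * t" using tM nn by (intro mult_left_mono) auto
      moreover have "C' * C' \<ge> 0" by simp
      ultimately show False using tM nn by linarith
    qed
    have sq: "\<bar>x\<bar> \<le> x * x + 1" for x :: real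
      using zero_le_square[of "\<bar>x\<bar> - 1"] abs_ge_zero[of x] by (simp add: algebra_simps)
    have tt: "t * t \<le> M * M" using t nn t_def by (intro mult_mono) auto
    show ?thesis
    proof (cases "i = n+1")
      case True
      hence "\<bar>u i\<bar> = t" by (simp add: t_def)
      thus ?thesis using sq[of t] tt nn unfolding L_def by linarith
    next
      case False
      hence "u i * u i \<le> T" unfolding T_def using i by (intro member_le_sum) auto
      thus ?thesis using sq[of "u i"] T tt unfolding L_def by linarith
    qed
  qed
  let ?B = "{x \<in> \<int>. \<bar>x\<bar> \<le> L}"
  have "{u. int_vec n u \<and> lor n u u \<le> K \<and> \<bar>lor n u (kappa n)\<bar> \<le> C}
     \<subseteq> {f. \<forall>i. (i \<in> {1..n+1} \<longrightarrow> f i \<in> ?B) \<and> (i \<notin> {1..n+1} \<longrightarrow> f i = 0)}"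
  proof (intro subsetI CollectI allI conjI impI)
    fix u i assume "u \<in> {u. int_vec n u \<and> lor n u u \<le> K \<and> \<bar>lor n u (kappa n)\<bar> \<le> C}"
    hence u: "int_vec n u" "lor n u u \<le> K" "\<bar>lor n u (kappa n)\<bar> \<le> C" by simp_all
    { assume "i \<in> {1..n+1}"
      from bound[OF u this] show "u i \<in> \<int>" "\<bar>u i\<bar> \<le> L"
        using u(1) by (simp_all add: int_vec_def) }
    { assume "i \<notin> {1..n+1}"
      thus "u i = 0" using int_vec_is_vec[OF u(1)] unfolding is_vec_def by blast }
  qed
  moreover have "finite \<dots>"
    by (intro finite_set_of_finite_funs finite_abs_int_segment) simp
  ultimately show ?thesis by (rule finite_subset)
qed

section \<open>Numerical constraints on exceptional vectors\<close>

lemma exceptionalD: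
  assumes "e \<in> exceptional n"
  shows "int_vec n e" "is_vec n e" "lor n e e = 1" "lor n e (kappa n) = -1"
  using assms by (auto simp: exceptional_def)

text \<open>\<open>sum_square_le\<close> turns the two equations for \<open>e\<close> into
  \<open>d * d - 3 * d \<le> 3\<close> for the time coordinate \<open>d\<close>, with integral
  solutions 0 to 3 only.\<close>

lemma exceptional_time_bounds:
  assumes e: "e \<in> exceptional n" and n: "n \<le> 7"
  shows "0 \<le> e (n+1)" "e (n+1) \<le> 3"
proof -
  define d where "d = e (n+1)"
  have d: "d \<in> \<int>" using exceptionalD(1)[OF e] by (simp add: d_def int_vec_def)
  have S: "(\<Sum>i=1..n. e i) = 3 * d - 1"
    using exceptionalD(4)[OF e] unfolding lor_kappa d_def by simp
  have T: "(\<Sum>i=1..n. e i * e i) = d * d + 1"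
    using exceptionalD(3)[OF e] unfolding lor_def d_def by simp
  have "(3 * d - 1)\<^sup>2 \<le> 7 * (d * d + 1)"
    using sum_square_le[OF n, of e] unfolding S T .
  hence q: "d * d - 3 * d \<le> 3" by (simp add: power2_eq_square algebra_simps)
  have "0 \<le> d \<and> d \<le> 3"
  proof (rule ccontr)
    assume "\<not> (0 \<le> d \<and> d \<le> 3)"
    hence "d < 0 \<or> 3 < d" by linarith
    hence "d + 1 \<le> 0 \<or> 3 + 1 \<le> d"
      using Ints_less_imp_add1_le[OF d Ints_0] Ints_less_imp_add1_le[OF Ints_numeral d, of "num.Bit1 num.One"]
      by blast
    \<comment> \<open>This product is \<open>d * d - 3 * d - 4\<close>, so its nonnegativity
      contradicts \<open>q\<close>.\<close>
    hence "0 \<le> (d + 1) * (d - 4)"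
      by (auto simp: zero_le_mult_iff)
    thus False using q by (simp add: algebra_simps)
  qed
  thus "0 \<le> e (n+1)" "e (n+1) \<le> 3" by (simp_all add: d_def)
qed

lemma Ints_square_ge:
  fixes x :: real assumes "x \<in> \<int>" shows "x \<le> x * x" "- x \<le> x * x"
proof -
  obtain k where k: "x = of_int k" using assms by (rule Ints_cases)
  have "k \<le> k * k" "- k \<le> k * k"
    by (smt (verit) mult_le_cancel_right1 mult_minus_left zero_le_mult_iff mult_le_cancel_left1)+
  thus "x \<le> x * x" "- x \<le> x * x"
    unfolding k by (metis of_int_le_iff of_int_mult of_int_minus)+
qed

text \<open>An entry above the time coordinate \<open>d\<close> has square at least
  \<open>(d + 1)^2\<close>, while all squares add up to \<open>d^2 + 1\<close>; so
  \<open>d = 0\<close>. Then the nonnegative numbers \<open>e j * e j + e j\<close> add up to 0,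
  which excludes a positive entry.\<close>

lemma exceptional_coord_le:
  assumes e: "e \<in> exceptional n" and n: "n \<le> 7" and i: "i \<in> {1..n}"
  shows "e i \<le> e (n+1)"
proof (rule ccontr)
  assume "\<not> e i \<le> e (n+1)"
  hence lt: "e (n+1) < e i" by simp
  define d where "d = e (n+1)"
  have I: "e j \<in> \<int>" for j using exceptionalD(1)[OF e] by (simp add: int_vec_def)
  have T: "(\<Sum>i=1..n. e i * e i) = d * d + 1"
    using exceptionalD(3)[OF e] unfolding lor_def d_def by simp
  have d0: "0 \<le> d" using exceptional_time_bounds[OF e n] by (simp add: d_def)
  have ge: "d + 1 \<le> e i" using Ints_less_imp_add1_le[OF I I lt] by (simp add: d_def)
  have "(d + 1) * (d + 1) \<le> e i * e i" using ge d0 by (intro mult_mono) auto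
  also have "\<dots> \<le> d * d + 1" unfolding T[symmetric] using i by (intro member_le_sum) auto
  finally have d: "d = 0" using d0 by (simp add: algebra_simps)
  have "(\<Sum>i=1..n. e i * e i + e i) = 0"
    using T exceptionalD(4)[OF e] unfolding lor_kappa sum.distrib d_def[symmetric] d by simp
  moreover have "0 \<le> e j * e j + e j" for j
    using Ints_square_ge(2)[OF I[of j]] by linarith
  hence "e i * e i + e i \<le> (\<Sum>i=1..n. e i * e i + e i)"
    using i by (intro member_le_sum) auto
  ultimately have "e i * e i + e i \<le> 0" by simp
  thus False using ge d zero_le_square[of "e i"] by linarith
qed

text \<open>All spatial entries add up to \<open>3 * d - 1\<close>, so it suffices that the tail
  beyond \<open>k\<close> is at least -1.\<close>

lemma exceptional_initial_sum_le:
  assumes e: "e \<in> exceptional n" and n: "n \<le> 7" and k: "k \<le> n"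
  shows "(\<Sum>i=1..k. e i) \<le> 3 * e (n+1)"
proof -
  define d where "d = e (n+1)"
  have I: "e j \<in> \<int>" for j using exceptionalD(1)[OF e] by (simp add: int_vec_def)
  have T: "(\<Sum>i=1..n. e i * e i) = d * d + 1"
    using exceptionalD(3)[OF e] unfolding lor_def d_def by simp
  have S: "(\<Sum>i=1..n. e i) = 3 * d - 1"
    using exceptionalD(4)[OF e] unfolding lor_kappa d_def by simp
  have "0 \<le> d" "d \<le> 3" using exceptional_time_bounds[OF e n] by (simp_all add: d_def)
  hence "d * (d - 3) \<le> 0" by (intro mult_nonneg_nonpos) auto
  hence D: "d * d - 3 * d \<le> 0" by (simp add: algebra_simps)
  have split: "(\<Sum>i=1..n. f i) = (\<Sum>i=1..k. f i) + (\<Sum>i=Suc k..n. f i)" for f :: "nat \<Rightarrow> real"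
    using sum.ub_add_nat[of 1 k f "n-k"] k by simp
  \<comment> \<open>Integers satisfy \<open>- 2 * x \<le> x * x - x\<close>, and the right-hand side
    summed over all entries is \<open>d * d - 3 * d + 2 \<le> 2\<close>, because \<open>d\<close>
    lies between 0 and 3.\<close>
  have "(\<Sum>i=Suc k..n. - 2 * e i) \<le> (\<Sum>i=Suc k..n. e i * e i - e i)"
    by (intro sum_mono) (use Ints_square_ge(2)[OF I] in \<open>simp add: algebra_simps\<close>)
  also have "\<dots> \<le> (\<Sum>i=1..n. e i * e i - e i)"
    unfolding split[of "\<lambda>i. e i * e i - e i"]
    by (simp add: sum_nonneg Ints_square_ge(1)[OF I])
  also have "\<dots> = d * d - 3 * d + 2"
    unfolding sum_subtractf S T by simp
  finally have "- 2 * (\<Sum>i=Suc k..n. e i) \<le> 2"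
    using D unfolding sum_distrib_left[symmetric] by linarith
  thus ?thesis using S split[of e] unfolding d_def by linarith
qed

section \<open>The simplicial cone over the simplex\<close>

text \<open>The cone spanned by \<open>\<Delta>\<^sup>n\<close> and its vertices; \<open>min n 3\<close> and \<open>min k 3\<close> absorb the special
  form of \<open>\<Delta>\<^sup>2\<close>, and index 0 stands for the vertex \<open>e\<^sub>n\<^sub>+\<^sub>1\<close>.\<close>
definition dcone :: "nat \<Rightarrow> (nat \<Rightarrow> real) set" where
  "dcone n = {x. is_vec n x \<and> (\<forall>i\<in>{1..<n}. x i \<ge> x (i+1)) \<and> x n \<ge> 0 \<and>
                 (\<Sum>i=1..min n 3. x i) \<le> x (n+1)}"

definition vtx :: "nat \<Rightarrow> nat \<Rightarrow> nat \<Rightarrow> real" where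
  "vtx n k = (if k = 0 then unit_vec (n+1)
     else (\<lambda>i. if i \<in> {1..k} then 1 else if i = n+1 then real (min k 3) else 0))"

definition dcoeff :: "nat \<Rightarrow> (nat \<Rightarrow> real) \<Rightarrow> nat \<Rightarrow> real" where
  "dcoeff n x k = (if k = 0 then x (n+1) - (\<Sum>i=1..min n 3. x i)
     else x k - (if k < n then x (k+1) else 0))"

lemma Delta_eq:
  assumes "2 \<le> n" shows "Delta n = hyp n \<inter> dcone n"
proof (cases "n = 2")
  case True
  thus ?thesis
    by (auto simp: Delta_def dcone_def hyp_def numeral_2_eq_2 numeral_3_eq_3 atLeastLessThanSuc)
next
  case False
  hence "min n 3 = 3" using assms by simp
  moreover have "(\<Sum>i=1..3. x i) = x 1 + x 2 + x 3" for x :: "nat \<Rightarrow> real"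
    by (simp add: numeral_3_eq_3 numeral_2_eq_2)
  ultimately show ?thesis using False by (auto simp: Delta_def dcone_def hyp_def)
qed

lemma dcoeff_nonneg:
  assumes "x \<in> dcone n" "k \<le> n" shows "0 \<le> dcoeff n x k"
proof -
  consider "k = 0" | "k \<in> {1..<n}" | "k = n" "k \<noteq> 0" using assms(2) by fastforce
  thus ?thesis
    using assms(1) by cases (auto simp: dcone_def dcoeff_def)
qed

lemma vtx_time:
  assumes "1 \<le> k" "k \<le> n" shows "vtx n k (n+1) = (\<Sum>i=1..min n 3. vtx n k i)"
proof -
  have "(\<Sum>i=1..min n 3. vtx n k i) = (\<Sum>i\<in>{1..min n 3}. if i \<in> {1..k} then 1 else 0)"
    using assms by (intro sum.cong) (auto simp: vtx_def)
  also have "\<dots> = (\<Sum>i\<in>{1..min n 3} \<inter> {1..k}. 1)"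
    by (subst sum.inter_restrict) auto
  also have "\<dots> = real (min k 3)" using assms by simp
  finally show ?thesis using assms by (simp add: vtx_def)
qed

text \<open>Abel summation: the slacks of the inequalities defining \<open>dcone\<close> are the
  coordinates with respect to the vertices.\<close>

lemma dcone_decomp:
  assumes x: "is_vec n x" and n: "n \<ge> 1"
  shows "x = (\<lambda>i. \<Sum>k=0..n. dcoeff n x k * vtx n k i)"
proof
  fix i
  have split: "(\<Sum>k=0..n. dcoeff n x k * vtx n k j)
    = dcoeff n x 0 * vtx n 0 j + (\<Sum>k=1..n. dcoeff n x k * vtx n k j)" for j
    by (simp add: sum.atLeast_Suc_atMost)
  have space: "(\<Sum>k=1..n. dcoeff n x k * vtx n k j) = x j" if j: "j \<in> {1..n}" for j
  proof -
    \<comment> \<open>The value \<open>x (n+1)\<close> is the time coordinate, so the entries are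
      cut off after \<open>n\<close> to let the telescoping sum end in 0.\<close>
    define y where "y k = (if k \<le> n then x k else 0)" for k
    have "(\<Sum>k=1..n. dcoeff n x k * vtx n k j) = (\<Sum>k\<in>{1..n}. if k \<in> {j..n} then y k - y (Suc k) else 0)"
      using j by (intro sum.cong) (auto simp: vtx_def dcoeff_def y_def)
    also have "\<dots> = (\<Sum>k\<in>{1..n} \<inter> {j..n}. y k - y (Suc k))"
      by (subst sum.inter_restrict) auto
    also have "{1..n} \<inter> {j..n} = {j..n}" using j by auto
    also have "(\<Sum>k\<in>{j..n}. y k - y (Suc k)) = y j - y (Suc n)"
      using j sum_Suc_diff[of j n "\<lambda>k. - y k"] by simp
    finally show ?thesis using j by (simp add: y_def)
  qed
  show "x i = (\<Sum>k=0..n. dcoeff n x k * vtx n k i)"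
  proof -
    consider "i \<in> {1..n}" | "i = n+1" | "i \<notin> {1..n+1}" by fastforce
    thus ?thesis
    proof cases
      case 1
      thus ?thesis using space[OF 1] unfolding split by (auto simp: vtx_def unit_vec_def)
    next
      case 2
      \<comment> \<open>The vertices 1 to \<open>n\<close> lie on the last wall, so their time
        coordinates are sums of spatial ones.\<close>
      have "(\<Sum>k=1..n. dcoeff n x k * vtx n k (n+1))
          = (\<Sum>k=1..n. \<Sum>j=1..min n 3. dcoeff n x k * vtx n k j)"
        by (intro sum.cong) (auto simp: vtx_time[simplified] sum_distrib_left)
      also have "\<dots> = (\<Sum>j=1..min n 3. \<Sum>k=1..n. dcoeff n x k * vtx n k j)"
        by (rule sum.swap)
      also have "\<dots> = (\<Sum>j=1..min n 3. x j)"
        by (intro sum.cong space) auto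
      finally show ?thesis
        unfolding 2 split by (simp add: vtx_def unit_vec_def dcoeff_def)
    next
      case 3
      hence "x i = 0" using x unfolding is_vec_def by blast
      moreover have "vtx n k i = 0" if "k \<le> n" for k
        using 3 that by (auto simp: vtx_def unit_vec_def)
      ultimately show ?thesis by simp
    qed
  qed
qed

lemma lor_sum_left: "lor n (\<lambda>i. \<Sum>k\<in>K. a k * w k i) z = (\<Sum>k\<in>K. a k * lor n (w k) z)"
proof -
  have "(\<Sum>i=1..n. (\<Sum>k\<in>K. a k * w k i) * z i) = (\<Sum>k\<in>K. a k * (\<Sum>i=1..n. w k i * z i))"
    unfolding sum_distrib_right sum_distrib_left by (subst sum.swap) (simp add: mult.assoc)
  thus ?thesis
    by (simp add: lor_def right_diff_distrib sum_subtractf sum_distrib_right mult.assoc)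
qed

lemma lor_vtx:
  assumes "k \<le> n"
  shows "lor n (vtx n k) z = (if k = 0 then - z (n+1) else (\<Sum>i=1..k. z i) - real (min k 3) * z (n+1))"
proof (cases "k = 0")
  case True
  thus ?thesis using lor_unit_vec[of "n+1" n z]
    by (simp add: vtx_def lor_commute[of n "unit_vec (Suc n)"] time_sign_def)
next
  case False
  have "(\<Sum>i=1..n. vtx n k i * z i) = (\<Sum>i\<in>{1..n}. if i \<in> {1..k} then z i else 0)"
    using False by (intro sum.cong) (auto simp: vtx_def)
  also have "\<dots> = (\<Sum>i\<in>{1..n} \<inter> {1..k}. z i)"
    by (subst sum.inter_restrict) auto
  also have "{1..n} \<inter> {1..k} = {1..k}" using assms by auto
  finally show ?thesis using False assms by (simp add: lor_def) (simp add: vtx_def)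
qed

lemma int_vec_vtx:
  assumes "k \<le> n" shows "int_vec n (vtx n k)"
  using assms by (auto simp: int_vec_def is_vec_def vtx_def unit_vec_def)

text \<open>For \<open>1 \<le> k \<le> 3\<close> the vertex has time coordinate \<open>k\<close> and
  the coordinatewise bound is added up; beyond that it is 3 and the bound on initial sums
  applies.\<close>

lemma lor_vtx_exceptional:
  assumes e: "e \<in> exceptional n" and n: "n \<le> 7" and k: "k \<le> n"
  shows "lor n (vtx n k) e \<le> 0"
proof -
  consider "k = 0" | "1 \<le> k" "k \<le> 3" | "k > 3" by linarith
  thus ?thesis
  proof cases
    case 1
    thus ?thesis using exceptional_time_bounds[OF e n] by (simp add: lor_vtx)
  next
    case 2
    have "(\<Sum>i=1..k. e i) \<le> (\<Sum>i=1..k. e (n+1))"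
      using exceptional_coord_le[OF e n] k by (intro sum_mono) auto
    thus ?thesis using 2 k by (simp add: lor_vtx)
  next
    case 3
    thus ?thesis using exceptional_initial_sum_le[OF e n k] k by (simp add: lor_vtx)
  qed
qed

text \<open>Prepares \<open>dcone_nonspacelike\<close>: a cone spanned by vectors whose products,
  norms included, are nonpositive contains no space-like vector.\<close>

lemma lor_vtx_vtx:
  assumes "j \<le> n" "k \<le> n" "n \<le> 7" shows "lor n (vtx n j) (vtx n k) \<le> 0"
proof -
  have *: "lor n (vtx n j) (vtx n k) \<le> 0" if jk: "1 \<le> j" "j \<le> k" "k \<le> n" for j k
  proof -
    have "(\<Sum>i=1..j. vtx n k i) = (\<Sum>i=1..j. 1)"
      using jk by (intro sum.cong) (auto simp: vtx_def)
    hence eq: "lor n (vtx n j) (vtx n k) = real j - real (min j 3) * real (min k 3)"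
      using jk by (simp add: lor_vtx) (simp add: vtx_def)
    \<comment> \<open>For \<open>j > 3\<close> the right-hand side is 9, which is above
      \<open>n\<close>.\<close>
    have "j \<le> min j 3 * min k 3"
    proof (cases "j \<le> 3")
      case True
      thus ?thesis using jk by simp
    next
      case False
      thus ?thesis using jk assms(3) by (simp add: min_def)
    qed
    hence "real j \<le> real (min j 3) * real (min k 3)"
      by (metis of_nat_le_iff of_nat_mult)
    thus ?thesis using eq by linarith
  qed
  have zero: "lor n (vtx n 0) (vtx n m) \<le> 0" for m
  proof -
    have "0 \<le> vtx n m (n+1)" by (simp add: vtx_def unit_vec_def)
    thus ?thesis using lor_vtx[of 0 n "vtx n m"] by simp
  qed
  consider "j = 0" | "k = 0" | "1 \<le> j" "j \<le> k" | "1 \<le> k" "k \<le> j" by linarith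
  thus ?thesis
  proof cases
    case 1
    thus ?thesis using zero by simp
  next
    case 2
    thus ?thesis using zero[of j] lor_commute[of n "vtx n j" "vtx n k"] by simp
  next
    case 3
    thus ?thesis using * assms by simp
  next
    case 4
    thus ?thesis using *[of k j] assms by (simp add: lor_commute)
  qed
qed

lemma lor_dcone_nonpos:
  assumes x: "x \<in> dcone n" and n: "n \<ge> 1" and z: "\<And>k. k \<le> n \<Longrightarrow> lor n (vtx n k) z \<le> 0"
  shows "lor n x z \<le> 0"
proof -
  have "lor n x z = (\<Sum>k=0..n. dcoeff n x k * lor n (vtx n k) z)"
    using x by (subst dcone_decomp[OF _ n, of x]) (auto simp: lor_sum_left dcone_def)
  also have "\<dots> \<le> 0"
    using dcoeff_nonneg[OF x] z by (intro sum_nonpos mult_nonneg_nonpos) auto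
  finally show ?thesis .
qed

lemma dcone_subset_nef:
  assumes "1 \<le> n" "n \<le> 7" shows "dcone n \<subseteq> nef n"
  using assms lor_dcone_nonpos lor_vtx_exceptional by (auto simp: nef_def dcone_def)

lemma dcone_nonspacelike:
  assumes "x \<in> dcone n" "1 \<le> n" "n \<le> 7" shows "lor n x x \<le> 0"
proof (rule lor_dcone_nonpos[OF assms(1,2)])
  fix k assume k: "k \<le> n"
  show "lor n (vtx n k) x \<le> 0"
    unfolding lor_commute[of n "vtx n k"]
    by (rule lor_dcone_nonpos[OF assms(1,2)]) (use k assms(3) lor_vtx_vtx in blast)
qed

lemma vtx_dcone:
  assumes "1 \<le> n" "k \<le> n" shows "vtx n k \<in> dcone n"
proof (cases "k = 0")
  case True
  have "(\<Sum>i=1..min n 3. vtx n 0 i) = 0"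
    by (intro sum.neutral) (auto simp: vtx_def unit_vec_def)
  thus ?thesis using True assms int_vec_is_vec[OF int_vec_vtx[OF assms(2)]]
    by (auto simp: dcone_def) (auto simp: vtx_def unit_vec_def)
next
  case False
  hence "(\<Sum>i=1..min n 3. vtx n k i) = vtx n k (n+1)" using vtx_time[of k n] assms by simp
  thus ?thesis using False assms int_vec_is_vec[OF int_vec_vtx[OF assms(2)]]
    by (auto simp: dcone_def) (auto simp: vtx_def)
qed

section \<open>The finite group generated by the simple reflections\<close>

definition swap_root :: "nat \<Rightarrow> nat \<Rightarrow> real" where
  "swap_root i = lc 1 (unit_vec i) (-1) (unit_vec (i+1))"

definition triple_root :: "nat \<Rightarrow> nat \<Rightarrow> real" where
  "triple_root n = (\<lambda>i. unit_vec 1 i + unit_vec 2 i + unit_vec 3 i + unit_vec (n+1) i)"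

text \<open>Up to sign the simple roots of the del Pezzo root system, of type A_1, A_2 x A_1, A_4,
  D_5, E_6, E_7 for \<open>n = 2, ..., 7\<close>.\<close>

definition simple_roots :: "nat \<Rightarrow> (nat \<Rightarrow> real) set" where
  "simple_roots n = swap_root ` {1..<n} \<union> (if n = 2 then {} else {triple_root n})"

definition kappa_stabilizer :: "nat \<Rightarrow> (nat \<Rightarrow> nat \<Rightarrow> real) set" where
  "kappa_stabilizer n = {A \<in> Gamma n. mat_vec n A (kappa n) = kappa n}"

text \<open>An integral point strictly inside the simple chamber: its product with each
  \<open>swap_root\<close> is 1, and with \<open>triple_root\<close> it is -3 when
  \<open>3 \<le> n\<close>.\<close>

definition rho :: "nat \<Rightarrow> nat \<Rightarrow> real" where
  "rho n = (\<lambda>i. if i \<in> {1..n} then real (n + 1 - i) else if i = n+1 then 3 * real n else 0)"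

lemma int_vec_rho: "int_vec n (rho n)"
  by (auto simp: int_vec_def is_vec_def rho_def)

lemma swap_mat_eq_lin_refl:
  assumes "1 \<le> i" "i < n" shows "swap_mat n i = lin_refl n 1 (swap_root i)"
proof (intro ext)
  fix a b
  show "swap_mat n i a b = lin_refl n 1 (swap_root i) a b"
    using assms
    by (cases "a = i"; cases "a = i+1"; cases "b = i"; cases "b = i+1")
      (auto simp: swap_mat_def lin_refl_def idm_def swap_root_def lc_def unit_vec_def)
qed

lemma Sigma_gens_eq:
  assumes "2 \<le> n" shows "Sigma_gens n = lin_refl n 1 ` simple_roots n"
proof -
  have swaps: "{swap_mat n i | i. 1 \<le> i \<and> i \<le> n - 1} = lin_refl n 1 ` swap_root ` {1..<n}"
  proof (intro equalityI subsetI)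
    fix A assume "A \<in> {swap_mat n i | i. 1 \<le> i \<and> i \<le> n - 1}"
    then obtain i where "A = swap_mat n i" "1 \<le> i" "i < n" using assms by auto
    thus "A \<in> lin_refl n 1 ` swap_root ` {1..<n}"
      using swap_mat_eq_lin_refl by auto
  next
    fix A assume "A \<in> lin_refl n 1 ` swap_root ` {1..<n}"
    then obtain i where "A = swap_mat n i" "1 \<le> i" "i < n"
      using swap_mat_eq_lin_refl by auto
    thus "A \<in> {swap_mat n i | i. 1 \<le> i \<and> i \<le> n - 1}" by auto
  qed
  have swaps2: "{swap_mat 2 i | i. 1 \<le> i \<and> i \<le> 2 - 1} = {swap_mat 2 1}"
    by (auto intro: le_antisym)
  show ?thesis
  proof (cases "n = 2")
    case True
    thus ?thesis
      using swaps unfolding True swaps2 Sigma_gens_def simple_roots_def by (simp only: simp_thms if_True Un_empty_right)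
  next
    case False
    thus ?thesis
      using swaps unfolding Sigma_gens_def simple_roots_def triple_root_def
      by (simp only: if_False image_Un image_insert image_empty)
  qed
qed

lemma lor_swap_root:
  assumes "1 \<le> i" "i < n" shows "lor n x (swap_root i) = x i - x (i+1)"
  using assms by (simp add: swap_root_def lor_unit_vec time_sign_def)

lemma triple_root_eq_lc:
  "triple_root n = lc 1 (lc 1 (unit_vec 1) 1 (unit_vec 2)) 1 (lc 1 (unit_vec 3) 1 (unit_vec (n+1)))"
  by (rule ext) (simp add: triple_root_def lc_def)

lemma lor_triple_root:
  assumes "3 \<le> n" shows "lor n x (triple_root n) = x 1 + x 2 + x 3 - x (n+1)"
  using assms by (simp add: triple_root_eq_lc lor_unit_vec time_sign_def)

lemma simple_rootD:
  assumes n: "2 \<le> n" and w: "w \<in> simple_roots n"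
  shows "int_vec n w" "lor n w w = 2" "lor n (kappa n) w = 0"
proof -
  consider i where "w = swap_root i" "1 \<le> i" "i < n" | "w = triple_root n" "3 \<le> n"
    using w n by (auto simp: simple_roots_def split: if_splits)
  hence "int_vec n w \<and> lor n w w = 2 \<and> lor n (kappa n) w = 0"
  proof cases
    case 1
    hence "int_vec n w"
      unfolding 1(1) swap_root_def by (intro int_vec_lc int_vec_unit_vec) auto
    moreover have "lor n w w = 2" "lor n (kappa n) w = 0"
      using 1 by (simp_all add: lor_swap_root) (simp_all add: swap_root_def lc_def unit_vec_def kappa_def)
    ultimately show ?thesis by blast
  next
    case 2
    hence "int_vec n w"
      unfolding 2(1) triple_root_eq_lc by (intro int_vec_lc int_vec_unit_vec) auto
    moreover have "lor n w w = 2" "lor n (kappa n) w = 0"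
      using 2 by (simp_all add: lor_triple_root) (simp_all add: triple_root_def unit_vec_def kappa_def)
    ultimately show ?thesis by blast
  qed
  thus "int_vec n w" "lor n w w = 2" "lor n (kappa n) w = 0" by blast+
qed

lemma lin_refl_simple_root_SigmaG:
  "2 \<le> n \<Longrightarrow> w \<in> simple_roots n \<Longrightarrow> lin_refl n 1 w \<in> SigmaG n"
  unfolding SigmaG_def by (intro gen_gen) (simp add: Sigma_gens_eq)

lemma kappa_stabilizer_adj:
  assumes "A \<in> kappa_stabilizer n" shows "adj n A \<in> kappa_stabilizer n"
proof -
  have A: "A \<in> Gamma n" "mat_vec n A (kappa n) = kappa n"
    using assms by (simp_all add: kappa_stabilizer_def)
  hence "mat_vec n (adj n A) (kappa n) = kappa n"
    using mat_vec_adj_cancel(1)[of n A "kappa n"] by simp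
  thus ?thesis using Gamma_adj[OF A(1)] by (simp add: kappa_stabilizer_def)
qed

text \<open>The simple roots are orthogonal to \<open>kappa\<close>, so their reflections fix
  it.\<close>

lemma SigmaG_subset_stabilizer:
  assumes "2 \<le> n" shows "SigmaG n \<subseteq> kappa_stabilizer n"
  unfolding SigmaG_def Sigma_gens_eq[OF assms]
proof (rule gen_grp_subset)
  show "lin_refl n 1 ` simple_roots n \<subseteq> kappa_stabilizer n"
  proof
    fix A assume "A \<in> lin_refl n 1 ` simple_roots n"
    then obtain w where w: "A = lin_refl n 1 w" "w \<in> simple_roots n" by blast
    note D = simple_rootD[OF assms w(2)]
    have "A \<in> Gamma n" unfolding w(1) using D by (intro Gamma_lin_refl) auto
    moreover have "mat_vec n A (kappa n) = kappa n"
      unfolding w(1) using D by (simp add: mat_vec_lin_refl refl_vec_def lc_def)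
    ultimately show "A \<in> kappa_stabilizer n" by (simp add: kappa_stabilizer_def)
  qed
qed (auto simp: kappa_stabilizer_def Gamma_idm Gamma_mult
      dest: kappa_stabilizer_adj[unfolded kappa_stabilizer_def, OF CollectI, OF conjI])

lemma exceptional_stabilizer:
  assumes "A \<in> kappa_stabilizer n" "e \<in> exceptional n" shows "mat_vec n A e \<in> exceptional n"
proof -
  have A: "A \<in> Gamma n" "mat_vec n A (kappa n) = kappa n"
    using assms(1) by (simp_all add: kappa_stabilizer_def)
  note e = exceptionalD[OF assms(2)]
  have "lor n (mat_vec n A e) (mat_vec n A (kappa n)) = -1"
    using A e by (subst lorentzian_lor) auto
  thus ?thesis
    using A e Gamma_int_vec[OF A(1) e(1)] by (simp add: exceptional_def lorentzian_lor)
qed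

lemma nef_stabilizer:
  assumes "A \<in> kappa_stabilizer n" "x \<in> nef n" shows "mat_vec n A x \<in> nef n"
  using assms exceptional_stabilizer[OF kappa_stabilizer_adj[OF assms(1)]]
  by (simp add: nef_def lor_mat_vec_left)

lemma ex_finite_max_on:
  fixes f :: "'a \<Rightarrow> real"
  assumes "finite (f ` S)" "S \<noteq> {}" shows "\<exists>s\<in>S. \<forall>t\<in>S. f t \<le> f s"
proof -
  have "Max (f ` S) \<in> f ` S" using assms by (intro Max_in) auto
  then obtain s where "s \<in> S" "f s = Max (f ` S)" by auto
  thus ?thesis using assms by (intro bexI[of _ s]) auto
qed

text \<open>A vector is moved into the simplicial cone by maximising its product with \<open>rho\<close>
  over the \<open>SigmaG\<close>-orbit: \<open>rho\<close> lies strictly on the inner side of all mirrors of simple roots.\<close>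
lemma SigmaG_simple_chamber:
  assumes n: "2 \<le> n" "n \<le> 7" and x: "is_vec n x"
  shows "\<exists>g\<in>SigmaG n. (\<forall>i\<in>{1..<n}. mat_vec n g x i \<ge> mat_vec n g x (i+1)) \<and>
     (3 \<le> n \<longrightarrow> mat_vec n g x 1 + mat_vec n g x 2 + mat_vec n g x 3 \<le> mat_vec n g x (n+1))"
proof -
  let ?f = "\<lambda>g. lor n (mat_vec n g x) (rho n)"
  have stab: "g \<in> kappa_stabilizer n" if "g \<in> SigmaG n" for g
    using that SigmaG_subset_stabilizer[OF n(1)] by blast
  \<comment> \<open>The orbit of \<open>rho\<close> lies in this finite set. Moving \<open>g\<close>
    to the other side of the product shows that \<open>?f\<close> takes finitely many values, hence
    has a maximum.\<close>
  let ?U = "{u. int_vec n u \<and> lor n u u \<le> lor n (rho n) (rho n) \<and>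
               \<bar>lor n u (kappa n)\<bar> \<le> \<bar>lor n (rho n) (kappa n)\<bar>}"
  have "?f ` SigmaG n \<subseteq> lor n x ` ?U"
  proof
    fix r assume "r \<in> ?f ` SigmaG n"
    then obtain g where g: "g \<in> SigmaG n" "r = ?f g" by blast
    let ?h = "adj n g"
    have h: "?h \<in> Gamma n" "mat_vec n ?h (kappa n) = kappa n"
      using kappa_stabilizer_adj[OF stab[OF g(1)]] by (simp_all add: kappa_stabilizer_def)
    have "lor n (mat_vec n ?h (rho n)) (mat_vec n ?h (kappa n)) = lor n (rho n) (kappa n)"
      using h(1) int_vec_rho by (subst lorentzian_lor) auto
    hence "mat_vec n ?h (rho n) \<in> ?U"
      using h Gamma_int_vec[OF h(1) int_vec_rho] int_vec_rho by (simp add: lorentzian_lor)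
    thus "r \<in> lor n x ` ?U" unfolding g(2) lor_mat_vec_left by blast
  qed
  hence "finite (?f ` SigmaG n)"
    using finite_bounded_int_vecs[OF n(2)] by (meson finite_imageI finite_subset)
  moreover have "SigmaG n \<noteq> {}" unfolding SigmaG_def using gen_id by blast
  ultimately obtain g where g: "g \<in> SigmaG n" "\<And>h. h \<in> SigmaG n \<Longrightarrow> ?f h \<le> ?f g"
    using ex_finite_max_on[of ?f "SigmaG n"] by blast
  let ?y = "mat_vec n g x"
  \<comment> \<open>Composing \<open>g\<close> with the reflection in \<open>w\<close> changes
    \<open>?f\<close> by minus this product.\<close>
  have *: "0 \<le> lor n ?y w * lor n (rho n) w" if w: "w \<in> simple_roots n" for w
  proof -
    have "mat_mult n (lin_refl n 1 w) g \<in> SigmaG n"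
      using lin_refl_simple_root_SigmaG[OF n(1) w] g(1) unfolding SigmaG_def by (rule gen_mult)
    from g(2)[OF this] have "lor n (refl_vec n 1 w ?y) (rho n) \<le> lor n ?y (rho n)"
      using simple_rootD(1)[OF n(1) w] by (simp add: mat_vec_lin_refl)
    thus ?thesis by (simp add: refl_vec_def lor_commute[of n w "rho n"])
  qed
  have "?y i \<ge> ?y (i+1)" if i: "i \<in> {1..<n}" for i
  proof -
    have "lor n (rho n) (swap_root i) = 1"
      using i by (simp add: lor_swap_root) (simp add: rho_def)
    thus ?thesis
      using *[of "swap_root i"] i by (simp add: simple_roots_def lor_swap_root)
  qed
  moreover have "?y 1 + ?y 2 + ?y 3 \<le> ?y (n+1)" if n3: "3 \<le> n"
  proof -
    have "lor n (rho n) (triple_root n) = -3"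
      using n3 by (simp add: lor_triple_root) (simp add: rho_def)
    thus ?thesis
      using *[of "triple_root n"] n3 by (simp add: simple_roots_def lor_triple_root)
  qed
  ultimately show ?thesis using g(1) by blast
qed

section \<open>From the nef cone to the simplex\<close>

lemma neg_unit_exceptional:
  assumes "i \<in> {1..n}" shows "lc (-1) (unit_vec i) 0 (unit_vec i) \<in> exceptional n"
proof -
  have "lor n (unit_vec i) (unit_vec i) = 1"
    using assms by (subst lor_unit_vec) (auto simp: time_sign_def unit_vec_def)
  moreover have "lor n (unit_vec i) (kappa n) = 1"
    unfolding lor_commute[of n "unit_vec i"]
    using assms by (subst lor_unit_vec) (auto simp: time_sign_def kappa_def)
  moreover have "int_vec n (lc (-1) (unit_vec i) 0 (unit_vec i))"
    using assms by (intro int_vec_lc int_vec_unit_vec) auto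
  ultimately show ?thesis by (simp add: exceptional_def)
qed

text \<open>The class of the line through the first two blown-up points. It gives the wall
  \<open>x 1 + x 2 \<le> x 3\<close> of the two-dimensional simplex and completes the negated unit
  vectors to a spanning set.\<close>

definition pair_vec :: "nat \<Rightarrow> nat \<Rightarrow> real" where
  "pair_vec n = lc 1 (lc 1 (unit_vec 1) 1 (unit_vec 2)) 1 (unit_vec (n+1))"

lemma lor_pair_vec: "2 \<le> n \<Longrightarrow> lor n x (pair_vec n) = x 1 + x 2 - x (n+1)"
  by (simp add: pair_vec_def lor_unit_vec time_sign_def)

lemma pair_exceptional:
  assumes "2 \<le> n" shows "pair_vec n \<in> exceptional n"
proof -
  have "int_vec n (pair_vec n)"
    unfolding pair_vec_def using assms by (intro int_vec_lc int_vec_unit_vec) auto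
  moreover have "lor n (pair_vec n) (pair_vec n) = 1"
    unfolding lor_pair_vec[OF assms] using assms by (simp add: pair_vec_def lc_def unit_vec_def)
  moreover have "lor n (pair_vec n) (kappa n) = -1"
    unfolding lor_commute[of n "pair_vec n"] lor_pair_vec[OF assms]
    using assms by (simp add: kappa_def)
  ultimately show ?thesis by (simp add: exceptional_def)
qed

text \<open>The finite group arranges the inequalities coming from simple roots; the remaining walls
  belong to exceptional vectors, \<open>- e_n\<close> and for \<open>n = 2\<close> also
  \<open>pair_vec\<close>, so nefness supplies them.\<close>

lemma nef_to_dcone:
  assumes n: "2 \<le> n" "n \<le> 7" and x: "x \<in> nef n"
  shows "\<exists>g\<in>SigmaG n. mat_vec n g x \<in> dcone n"
proof -
  have "is_vec n x" using x by (simp add: nef_def)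
  then obtain g where g: "g \<in> SigmaG n"
    "\<forall>i\<in>{1..<n}. mat_vec n g x i \<ge> mat_vec n g x (i+1)"
    "3 \<le> n \<Longrightarrow> mat_vec n g x 1 + mat_vec n g x 2 + mat_vec n g x 3 \<le> mat_vec n g x (n+1)"
    using SigmaG_simple_chamber[OF n] by blast
  let ?y = "mat_vec n g x"
  have y: "?y \<in> nef n"
    using g(1) SigmaG_subset_stabilizer[OF n(1)] x nef_stabilizer by blast
  have "lor n ?y (lc (-1) (unit_vec n) 0 (unit_vec n)) \<le> 0"
    using y neg_unit_exceptional[of n n] n by (auto simp: nef_def)
  hence "?y n \<ge> 0"
    using n by (simp add: lor_unit_vec time_sign_def)
  moreover have "(\<Sum>i=1..min n 3. ?y i) \<le> ?y (n+1)"
  proof (cases "n = 2")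
    case True
    have "lor n ?y (pair_vec n) \<le> 0" using y pair_exceptional[OF n(1)] by (simp add: nef_def)
    thus ?thesis using True lor_pair_vec[OF n(1), of ?y] by (simp add: numeral_2_eq_2)
  next
    case False
    hence n3: "3 \<le> n" using n by simp
    moreover have "(\<Sum>i=1..3. ?y i) = ?y 1 + ?y 2 + ?y 3"
      by (simp add: numeral_3_eq_3 numeral_2_eq_2)
    ultimately show ?thesis using g(3)[OF n3] by (simp add: min_absorb2)
  qed
  ultimately have "?y \<in> dcone n" using g(2) by (simp add: dcone_def)
  thus ?thesis using g(1) by blast
qed

text \<open>The finite group acts by isometries, so the norm can be read off in
  \<open>dcone\<close>. In particular a unit vector is never nef, which starts each descent step
  below.\<close>

lemma nef_nonspacelike:
  assumes n: "2 \<le> n" "n \<le> 7" and x: "x \<in> nef n"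
  shows "lor n x x \<le> 0"
proof -
  obtain g where g: "g \<in> SigmaG n" "mat_vec n g x \<in> dcone n"
    using nef_to_dcone[OF assms] by blast
  have "lorentzian n g"
    using SigmaG_subset_stabilizer[OF n(1)] g(1) by (auto simp: kappa_stabilizer_def)
  moreover have "lor n (mat_vec n g x) (mat_vec n g x) \<le> 0"
    using dcone_nonspacelike[OF g(2)] n by simp
  ultimately show ?thesis using x by (simp add: nef_def lorentzian_lor)
qed

lemma Pn_eq:
  assumes n: "2 \<le> n" "n \<le> 7" shows "Pn n = hyp n \<inter> nef n"
proof (intro equalityI subsetI)
  fix x assume "x \<in> Pn n"
  then obtain g y where g: "g \<in> SigmaG n" "y \<in> Delta n" "x = mat_vec n g y"
    by (auto simp: Pn_def act_def)
  have "y \<in> hyp n" "y \<in> nef n"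
    using g(2) dcone_subset_nef[of n] n by (auto simp: Delta_eq)
  moreover have "g \<in> kappa_stabilizer n" using g(1) SigmaG_subset_stabilizer[OF n(1)] by blast
  ultimately show "x \<in> hyp n \<inter> nef n"
    unfolding g(3) using nef_stabilizer hyp_mat_vec by (simp add: kappa_stabilizer_def)
next
  fix x assume x: "x \<in> hyp n \<inter> nef n"
  then obtain g where g: "g \<in> SigmaG n" "mat_vec n g x \<in> dcone n"
    using nef_to_dcone[OF n] by blast
  have G: "g \<in> Gamma n"
    using SigmaG_subset_stabilizer[OF n(1)] g(1) by (auto simp: kappa_stabilizer_def)
  have "mat_vec n g x \<in> Delta n"
    using g(2) hyp_mat_vec[OF G] x by (simp add: Delta_eq n)
  moreover have "x = mat_vec n (adj n g) (mat_vec n g x)"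
    using G x by (simp add: hyp_def)
  moreover have "adj n g \<in> SigmaG n"
    using g(1) G unfolding SigmaG_def by (intro gen_grp_adj) auto
  ultimately show "x \<in> Pn n" unfolding Pn_def act_def by blast
qed

section \<open>Integral unit vectors and the action of the congruence subgroup\<close>

definition nef_int :: "nat \<Rightarrow> (nat \<Rightarrow> real) set" where
  "nef_int n = {x. is_vec n x \<and> (\<forall>e\<in>exceptional n. lor n x e < 0)}"

lemma nef_int_nef: "x \<in> nef_int n \<Longrightarrow> x \<in> nef n"
  by (force simp: nef_int_def nef_def)

lemma kappa_nef_int: "kappa n \<in> nef_int n"
  by (auto simp: nef_int_def lor_commute[of n "kappa n"] exceptionalD(4))

lemma odd_Ints:
  fixes x :: real assumes "(1 - x) / 2 \<in> \<int>"
  shows "x \<noteq> 0" "x < 0 \<Longrightarrow> x = -1 \<or> x \<le> -3"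
proof -
  obtain k where "(1 - x) / 2 = of_int k" using assms by (rule Ints_cases)
  hence x: "x = 1 - 2 * of_int k" by simp
  consider "k \<le> 0" | "k = 1" | "k \<ge> 2" by linarith
  hence "x \<ge> 1 \<or> x = -1 \<or> x \<le> -3"
    by cases (simp_all add: x)
  thus "x \<noteq> 0" "x < 0 \<Longrightarrow> x = -1 \<or> x \<le> -3" by auto
qed

text \<open>Parity from the characteristic vector: with \<open>odd_Ints\<close>, the product is
  nonzero, and if negative it is -1 or at most -3.\<close>

lemma int_unit_kappa_odd:
  assumes "int_vec n r" "lor n r r = 1" shows "(1 - lor n r (kappa n)) / 2 \<in> \<int>"
  using kappa_characteristic[OF assms(1)] by (simp add: assms(2))

lemma kappa_timelike: "n \<le> 7 \<Longrightarrow> lor n (kappa n) (kappa n) < 0"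
  by simp

text \<open>Ensures that reflecting \<open>r\<close> in \<open>e\<close> keeps its product with
  \<open>kappa\<close> negative. Otherwise Cauchy-Schwarz in the complement of \<open>kappa\<close>
  would give \<open>N * m^2 \<le> 4 * N + 4\<close>, impossible for \<open>N \<ge> 2\<close> and
  \<open>m \<ge> 3\<close>.\<close>

lemma int_unit_exceptional_bound:
  assumes n: "n \<le> 7" and r: "lor n r r = 1" "lor n r (kappa n) \<le> -3" and e: "e \<in> exceptional n"
  shows "2 * lor n r e < - lor n r (kappa n)"
proof (rule ccontr)
  define N m b where "N = 9 - real n" and "m = - lor n r (kappa n)" and "b = lor n r e"
  assume "\<not> 2 * lor n r e < - lor n r (kappa n)"
  hence b: "m \<le> 2 * b" by (simp add: m_def b_def)
  have N: "N \<ge> 2" using n by (simp add: N_def)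
  have m: "m \<ge> 3" using r by (simp add: m_def)
  have "(lor n r e * lor n (kappa n) (kappa n) - lor n r (kappa n) * lor n e (kappa n))\<^sup>2
       \<le> (lor n r r * lor n (kappa n) (kappa n) - (lor n r (kappa n))\<^sup>2)
         * (lor n e e * lor n (kappa n) (kappa n) - (lor n e (kappa n))\<^sup>2)"
    using kappa_timelike[OF n] exceptionalD(2)[OF e] by (intro lor_reverse_Cauchy_Schwarz) auto
  moreover have "lor n (kappa n) (kappa n) = - N" "lor n r (kappa n) = - m"
    by (simp_all add: N_def m_def)
  ultimately have "(b * (- N) - (- m) * (- 1))\<^sup>2 \<le> (1 * (- N) - (- m)\<^sup>2) * (1 * (- N) - (- 1)\<^sup>2)"
    unfolding b_def by (simp only: exceptionalD(3,4)[OF e] r(1))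
  hence cs: "(N * b + m)\<^sup>2 \<le> (N + m * m) * (N + 1)"
    by (simp add: power2_eq_square algebra_simps)
  have "N * m \<le> N * (2 * b)" using b N by (intro mult_left_mono) auto
  hence le: "(N + 2) * m \<le> 2 * (N * b + m)" by (simp add: algebra_simps)
  have "((N + 2) * m)\<^sup>2 \<le> (2 * (N * b + m))\<^sup>2"
    using le N m by (intro power_mono) auto
  also have "\<dots> = 4 * (N * b + m)\<^sup>2" unfolding power_mult_distrib by simp
  also have "\<dots> \<le> 4 * ((N + m * m) * (N + 1))" using cs by simp
  finally have "N * (N * (m * m)) \<le> N * (4 * N + 4)"
    by (simp add: power2_eq_square algebra_simps)
  hence "N * (m * m) \<le> 4 * N + 4" using N by simp
  moreover have "3 * 3 \<le> m * m" using m by (intro mult_mono) auto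
  hence "N * 9 \<le> N * (m * m)" using N by (intro mult_left_mono) auto
  ultimately show False using N by linarith
qed

lemma is_vec_refl_vec [simp]: "is_vec n w \<Longrightarrow> is_vec n x \<Longrightarrow> is_vec n (refl_vec n c w x)"
  by (simp add: refl_vec_def)

lemma int_vec_refl_vec:
  assumes "int_vec n w" "int_vec n x" "c \<in> \<int>" shows "int_vec n (refl_vec n c w x)"
  unfolding refl_vec_def using assms by (intro int_vec_lc Ints_minus Ints_mult lor_Ints) auto

text \<open>The mirrors of integral unit vectors do not cross the nef cone: reflecting \<open>r\<close> in an
  exceptional vector that it meets positively brings it closer to \<open>kappa\<close>.\<close>
lemma int_unit_nef_nonpos:
  assumes n: "2 \<le> n" "n \<le> 7" and z: "z \<in> nef n"
    and "int_vec n r" "lor n r r = 1" "lor n r (kappa n) < 0"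
  shows "lor n r z \<le> 0"
  using assms(4-6)
proof (induction "nat \<lfloor>- lor n r (kappa n)\<rfloor>" arbitrary: r rule: less_induct)
  case less
  note r = less.prems
  have "lor n r (kappa n) = -1 \<or> lor n r (kappa n) \<le> -3"
    using odd_Ints(2)[OF int_unit_kappa_odd[OF r(1,2)] r(3)] .
  thus ?case
  proof
    assume "lor n r (kappa n) = -1"
    hence "r \<in> exceptional n" using r by (simp add: exceptional_def)
    thus ?thesis using z by (simp add: nef_def lor_commute[of n r z])
  next
    assume m: "lor n r (kappa n) \<le> -3"
    have "r \<notin> nef n" using nef_nonspacelike[OF n, of r] r(2) by auto
    then obtain e where e: "e \<in> exceptional n" "lor n r e > 0"
      using r(1) by (auto simp: nef_def not_le)
    note E = exceptionalD[OF e(1)]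
    let ?r = "refl_vec n 2 e r"
    have i: "int_vec n ?r" using E r by (intro int_vec_refl_vec) auto
    have u: "lor n ?r ?r = 1" using E r by (simp add: lor_refl_vec)
    have k: "lor n ?r (kappa n) = lor n r (kappa n) + 2 * lor n r e"
      using E by (simp add: refl_vec_def)
    have neg: "lor n ?r (kappa n) < 0"
      using int_unit_exceptional_bound[OF n(2) r(2) m e(1)] k by simp
    have "0 + 1 \<le> lor n r e"
      using E(1) r(1) e(2) by (intro Ints_less_imp_add1_le) auto
    hence "nat \<lfloor>- lor n ?r (kappa n)\<rfloor> < nat \<lfloor>- lor n r (kappa n)\<rfloor>"
      using neg unfolding k by linarith
    from less.hyps[OF this i u neg] have "lor n ?r z \<le> 0" .
    moreover have "lor n r z = lor n ?r z + 2 * lor n r e * lor n e z"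
      by (simp add: refl_vec_def)
    moreover have "lor n e z \<le> 0" using z e(1) by (simp add: nef_def lor_commute[of n e z])
    hence "2 * lor n r e * lor n e z \<le> 0" using e(2) by (intro mult_nonneg_nonpos) auto
    ultimately show ?thesis by linarith
  qed
qed

text \<open>Half the difference is an integral \<open>u\<close> orthogonal to \<open>kappa\<close>,
  so its norm is even. Cauchy-Schwarz bounds the norm by 3/2, hence it is 0, and definiteness gives
  \<open>u = 0\<close>.\<close>

lemma exceptional_congruent_eq:
  assumes n: "n \<le> 7" and e: "e \<in> exceptional n" and f: "f \<in> exceptional n"
    and c: "\<And>i. (f i - e i) / 2 \<in> \<int>"
  shows "f = e"
proof -
  note E = exceptionalD[OF e] and F = exceptionalD[OF f]
  define N b where "N = 9 - real n" and "b = lor n f e"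
  have N: "N \<ge> 2" using n by (simp add: N_def)
  define u where "u = lc (1/2) f (-1/2) e"
  have u: "int_vec n u"
    using E(2) F(2) c unfolding int_vec_def u_def by (simp add: lc_def[of _ f] diff_divide_distrib) (simp add: is_vec_def)
  have uk: "lor n u (kappa n) = 0" by (simp add: u_def E F)
  have uu: "lor n u u = (1 - b) / 2"
    by (simp add: u_def E F b_def lor_commute[of n e f] algebra_simps)
  have "(lor n f e * lor n (kappa n) (kappa n) - lor n f (kappa n) * lor n e (kappa n))\<^sup>2
       \<le> (lor n f f * lor n (kappa n) (kappa n) - (lor n f (kappa n))\<^sup>2)
         * (lor n e e * lor n (kappa n) (kappa n) - (lor n e (kappa n))\<^sup>2)"
    using kappa_timelike[OF n] E(2) by (intro lor_reverse_Cauchy_Schwarz) auto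
  moreover have "lor n (kappa n) (kappa n) = - N" by (simp add: N_def)
  ultimately have "(b * (- N) - (- 1) * (- 1))\<^sup>2 \<le> (1 * (- N) - (- 1)\<^sup>2) * (1 * (- N) - (- 1)\<^sup>2)"
    unfolding b_def by (simp only: E(3,4) F(3,4))
  hence "(N * b + 1)\<^sup>2 \<le> (N + 1)\<^sup>2"
    by (simp add: power2_eq_square algebra_simps)
  hence "\<bar>N * b + 1\<bar> \<le> N + 1" using N by (intro power2_le_iff_abs_le[THEN iffD1]) auto
  hence Nb: "- N - 2 \<le> N * b" by linarith
  \<comment> \<open>From \<open>Nb\<close> one has \<open>b \<ge> -1 - 2 / N\<close>, and
    \<open>N \<ge> 2\<close>. The norm \<open>(1 - b) / 2\<close> of \<open>u\<close> thus stays
    below 2.\<close>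
  have b: "b \<ge> -2"
  proof (rule ccontr)
    assume "\<not> b \<ge> -2"
    hence "N * b < N * (-2)" using N by (intro mult_strict_left_mono) auto
    thus False using Nb N by linarith
  qed
  have nn: "0 \<le> lor n u u" using time_orthogonal_nonneg[OF kappa_timelike[OF n] uk] .
  obtain k where k: "lor n u u / 2 = of_int k"
    using kappa_characteristic[OF u] unfolding uk by (auto elim: Ints_cases)
  have "4 * real_of_int k = 1 - b" using k unfolding uu by simp
  hence "0 \<le> real_of_int k \<and> real_of_int k < 1" using b nn uu by auto
  hence "k = 0" by auto
  hence "u = (\<lambda>_. 0)"
    using k by (intro time_orthogonal_null[OF kappa_timelike[OF n] uk] int_vec_is_vec[OF u]) simp
  hence "u i = 0" for i by simp
  thus ?thesis by (intro ext) (simp add: u_def lc_def)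
qed

text \<open>If \<open>A e\<close> had positive product with \<open>kappa\<close>, then
  \<open>- A e\<close> would be nonpositive on the nef vector \<open>A x\<close>, against
  \<open><A e, A x> = <e, x> < 0\<close>. Parity excludes the value 0.\<close>

lemma Gamma_exceptional_negative:
  assumes n: "2 \<le> n" "n \<le> 7" and A: "A \<in> Gamma n"
    and x: "x \<in> nef_int n" "mat_vec n A x \<in> nef n" and e: "e \<in> exceptional n"
  shows "lor n (mat_vec n A e) (kappa n) \<le> -1"
proof -
  note E = exceptionalD[OF e]
  let ?r = "mat_vec n A e"
  have r: "int_vec n ?r" "lor n ?r ?r = 1"
    using A E by (auto simp: lorentzian_lor)
  note odd = odd_Ints[OF int_unit_kappa_odd[OF r]]
  have neg: "lor n ?r (mat_vec n A x) < 0"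
    using x(1) A E e by (subst lorentzian_lor) (auto simp: nef_int_def lor_commute[of n e x])
  have "\<not> lor n ?r (kappa n) > 0"
  proof
    assume pos: "lor n ?r (kappa n) > 0"
    let ?s = "lc (-1) ?r 0 ?r"
    have "lor n ?s (mat_vec n A x) \<le> 0"
      using r pos by (intro int_unit_nef_nonpos[OF n x(2)]) auto
    thus False using neg by simp
  qed
  thus ?thesis using odd by linarith
qed

text \<open>The negated unit vectors and \<open>pair_vec\<close> span the whole space.\<close>

lemma fixes_exceptional_imp_idm:
  assumes n: "2 \<le> n" and A: "lorentzian n A" "\<And>e. e \<in> exceptional n \<Longrightarrow> mat_vec n A e = e"
  shows "A = idm n"
proof (rule mat_eqI)
  fix x assume x: "is_vec n x"
  define d where "d = lc 1 (mat_vec n A x) (-1) x"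
  have d: "is_vec n d" using x by (simp add: d_def)
  have orth: "lor n d e = 0" if e: "e \<in> exceptional n" for e
  proof -
    have "lor n (mat_vec n A x) (mat_vec n A e) = lor n x e"
      using A(1) x exceptionalD(2)[OF e] by (rule lorentzian_lor)
    thus ?thesis by (simp add: d_def A(2)[OF e])
  qed
  have s: "d i = 0" if "i \<in> {1..n}" for i
    using orth[OF neg_unit_exceptional[OF that]] that by (simp add: lor_unit_vec time_sign_def)
  have t: "d (n+1) = 0"
    using orth[OF pair_exceptional[OF n]] s[of 1] s[of 2] n by (simp add: lor_pair_vec)
  have "d i = 0" for i
  proof (cases "i \<in> {1..n+1}")
    case True
    thus ?thesis using s t by (cases "i = n+1") auto
  next
    case False
    thus ?thesis using d unfolding is_vec_def by blast
  qed
  thus "mat_vec n A x = mat_vec n (idm n) x"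
    using x by (intro ext) (simp add: d_def lc_def)
qed (use A(1) in \<open>simp_all add: lorentzian_def\<close>)

text \<open>The displacement of \<open>kappa\<close> is nef, which squeezes the product of
  \<open>A e\<close> with \<open>kappa\<close> to exactly -1. So \<open>A e\<close> is exceptional,
  and being congruent to \<open>e\<close> modulo 2 it equals \<open>e\<close>.\<close>

lemma Gamma2_nef_int_trivial:
  assumes n: "2 \<le> n" "n \<le> 7" and A: "A \<in> Gamma2 n"
    and x: "x \<in> nef_int n" "mat_vec n A x \<in> nef_int n"
  shows "A = idm n"
proof (rule fixes_exceptional_imp_idm[OF n(1)])
  have G: "A \<in> Gamma n" "adj n A \<in> Gamma n" using A by (auto intro: Gamma_adj)
  show "lorentzian n A" using G by simp
  fix e assume e: "e \<in> exceptional n"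
  note E = exceptionalD[OF e]
  have xv: "is_vec n x" using x by (simp add: nef_int_def)
  \<comment> \<open>Nef because \<open><A kappa, f> = <kappa, adj A f> \<le> -1 = <kappa, f>\<close>
    for exceptional \<open>f\<close>.\<close>
  let ?z = "lc 1 (mat_vec n A (kappa n)) (-1) (kappa n)"
  have "?z \<in> nef n"
  proof -
    have "lor n ?z f \<le> 0" if f: "f \<in> exceptional n" for f
    proof -
      have "mat_vec n (adj n A) (mat_vec n A x) \<in> nef n"
        using x(1) G(1) xv by (simp add: nef_int_nef)
      from Gamma_exceptional_negative[OF n G(2) x(2) this f]
      have "lor n (mat_vec n A (kappa n)) f \<le> -1"
        by (simp add: lor_mat_vec_left lor_commute[of n "kappa n"])
      thus ?thesis using exceptionalD(4)[OF f] by (simp add: lor_commute[of n "kappa n" f])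
    qed
    thus ?thesis by (simp add: nef_def)
  qed
  moreover have r: "int_vec n (mat_vec n A e)" "lor n (mat_vec n A e) (mat_vec n A e) = 1"
    using G E by (auto simp: lorentzian_lor)
  moreover have neg: "lor n (mat_vec n A e) (kappa n) \<le> -1"
    using Gamma_exceptional_negative[OF n G(1) x(1) nef_int_nef[OF x(2)] e] .
  \<comment> \<open>The left-hand side is \<open>-1 - <A e, kappa>\<close>, so this is the bound
    opposite to \<open>neg\<close>.\<close>
  ultimately have "lor n (mat_vec n A e) ?z \<le> 0"
    by (intro int_unit_nef_nonpos[OF n]) auto
  moreover have "lor n (mat_vec n A e) (mat_vec n A (kappa n)) = -1"
    using G E by (simp add: lorentzian_lor)
  ultimately have "lor n (mat_vec n A e) (kappa n) = -1" using neg by simp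
  hence "mat_vec n A e \<in> exceptional n" using r by (simp add: exceptional_def)
  thus "mat_vec n A e = e"
    using exceptional_congruent_eq[OF n(2) e] Gamma2_congruent[OF A E(1)] by blast
qed

lemma Gamma_kappa_timelike:
  assumes n: "n \<le> 7" and A: "A \<in> Gamma n"
  shows "lor n (mat_vec n A (kappa n)) (mat_vec n A (kappa n)) = real n - 9"
    "mat_vec n A (kappa n) (n+1) > 0"
  using A positive_lorentzian_timelike[OF Gamma_positive[OF A], of "kappa n"] n
  by (simp_all add: lorentzian_lor)

text \<open>Descent on the distance from \<open>kappa\<close> to its image.\<close>
lemma Gamma2_descent:
  assumes n: "2 \<le> n" "n \<le> 7" and "A \<in> Gamma2 n"
  shows "A \<in> gen_grp n (lin_refl n 2 ` exceptional n) \<and>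
    (\<forall>p\<in>nef n. lor n p (mat_vec n A (kappa n)) \<le> lor n p (kappa n))"
  using assms(3)
proof (induction "nat \<lfloor>- lor n (mat_vec n A (kappa n)) (kappa n)\<rfloor>" arbitrary: A rule: less_induct)
  case less
  note A = less.prems
  let ?u = "mat_vec n A (kappa n)"
  have ui: "int_vec n ?u" using A by auto
  show ?case
  proof (cases "\<exists>e\<in>exceptional n. lor n ?u e > 0")
    case False
    \<comment> \<open>By parity no orbit point of \<open>kappa\<close> lies on a wall, so in this
      case \<open>?u\<close> is strictly inside the nef cone.\<close>
    have "lor n ?u e \<noteq> 0" if e: "e \<in> exceptional n" for e
    proof -
      have r: "int_vec n (mat_vec n (adj n A) e)"
        "lor n (mat_vec n (adj n A) e) (mat_vec n (adj n A) e) = 1"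
        using exceptionalD[OF e] A Gamma_int_vec[OF Gamma_adj[OF Gamma2_Gamma[OF A]]]
        by (simp_all add: lorentzian_lor lorentzian_adj)
      have "lor n ?u e = lor n (mat_vec n (adj n A) e) (kappa n)"
        by (simp add: lor_mat_vec_left lor_commute[of n "kappa n"])
      thus ?thesis using odd_Ints(1)[OF int_unit_kappa_odd[OF r]] by simp
    qed
    hence "?u \<in> nef_int n" using False by (force simp: nef_int_def)
    hence "A = idm n" using Gamma2_nef_int_trivial[OF n A kappa_nef_int] by blast
    thus ?thesis using gen_id by simp
  next
    case True
    then obtain e where e: "e \<in> exceptional n" "lor n ?u e > 0" by blast
    note E = exceptionalD[OF e(1)]
    let ?R = "lin_refl n 2 e" and ?B = "mat_mult n (lin_refl n 2 e) A"
    have R: "?R \<in> Gamma2 n" using E by (intro Gamma2_lin_refl)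
    have B: "?B \<in> Gamma2 n" using R A by (rule Gamma2_mult)
    have Bu: "mat_vec n ?B (kappa n) = refl_vec n 2 e ?u"
      using E by (simp add: mat_vec_lin_refl)
    have Bk: "lor n (mat_vec n ?B (kappa n)) (kappa n) = lor n ?u (kappa n) + 2 * lor n ?u e"
      unfolding Bu using E by (simp add: refl_vec_def)
    have "lor n (kappa n) (mat_vec n ?B (kappa n)) < 0"
      using Gamma_kappa_timelike[OF n(2) Gamma2_Gamma[OF B]] n
      by (subst timelike_same_sheet) auto
    hence neg: "lor n (mat_vec n ?B (kappa n)) (kappa n) < 0"
      by (simp only: lor_commute[of n "kappa n" "mat_vec n ?B (kappa n)"])
    have "0 + 1 \<le> lor n ?u e"
      using E(1) ui e(2) by (intro Ints_less_imp_add1_le) auto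
    hence "nat \<lfloor>- lor n (mat_vec n ?B (kappa n)) (kappa n)\<rfloor> < nat \<lfloor>- lor n ?u (kappa n)\<rfloor>"
      using neg unfolding Bk by linarith
    from less.hyps[OF this B]
    have IH: "?B \<in> gen_grp n (lin_refl n 2 ` exceptional n)"
      "\<And>p. p \<in> nef n \<Longrightarrow> lor n p (refl_vec n 2 e ?u) \<le> lor n p (kappa n)"
      unfolding Bu by blast+
    have "A = mat_mult n ?R ?B"
      using A E Gamma_lorentzian[OF Gamma2_Gamma[OF A]]
      by (intro mat_eqI) (auto simp: lorentzian_def mat_vec_lin_refl refl_vec_refl_vec)
    moreover have "?R \<in> gen_grp n (lin_refl n 2 ` exceptional n)"
      using e(1) by (intro gen_gen) auto
    ultimately have "A \<in> gen_grp n (lin_refl n 2 ` exceptional n)"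
      using IH(1) gen_mult by metis
    \<comment> \<open>Undoing the reflection only lowers the product with a nef \<open>p\<close>.
      Thus \<open>kappa\<close> is the point of its orbit closest to \<open>p\<close>: the nef cone
      lies in the Dirichlet domain of \<open>kappa\<close>.\<close>
    moreover have "lor n p ?u \<le> lor n p (kappa n)" if p: "p \<in> nef n" for p
    proof -
      have "lor n p ?u = lor n p (refl_vec n 2 e ?u) + 2 * lor n ?u e * lor n p e"
        by (simp add: refl_vec_def)
      moreover have "2 * lor n ?u e * lor n p e \<le> 0"
        using e p by (intro mult_nonneg_nonpos) (auto simp: nef_def)
      ultimately show ?thesis using IH(2)[OF p] by linarith
    qed
    ultimately show ?thesis by blast
  qed
qed

section \<open>Generation, discreteness and covering\<close>

lemma Gamma2_eq_gen_grp:
  assumes "2 \<le> n" "n \<le> 7" shows "Gamma2 n = gen_grp n (lin_refl n 2 ` exceptional n)"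
proof
  show "Gamma2 n \<subseteq> gen_grp n (lin_refl n 2 ` exceptional n)"
    using Gamma2_descent[OF assms] by blast
  show "gen_grp n (lin_refl n 2 ` exceptional n) \<subseteq> Gamma2 n"
  proof (rule gen_grp_subset)
    show "lin_refl n 2 ` exceptional n \<subseteq> Gamma2 n"
      by (intro image_subsetI Gamma2_lin_refl exceptionalD(1,3))
  qed (auto intro: Gamma2_idm Gamma2_mult Gamma2_adj)
qed

lemma hyp_lor_kappa_neg:
  assumes "n \<le> 7" "x \<in> hyp n" "A \<in> Gamma n" shows "lor n x (mat_vec n A (kappa n)) < 0"
  using assms Gamma_kappa_timelike[OF assms(1,3)]
  by (subst timelike_same_sheet) (auto simp: hyp_def)

text \<open>An element is determined by its image of \<open>kappa\<close>, since an element fixing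
  \<open>kappa\<close> is trivial; the images are integral vectors of fixed norm.\<close>

lemma Gamma2_kappa_bounded_finite:
  assumes n: "2 \<le> n" "n \<le> 7"
  shows "finite {A \<in> Gamma2 n. \<bar>lor n (mat_vec n A (kappa n)) (kappa n)\<bar> \<le> C}"
proof -
  let ?S = "{A \<in> Gamma2 n. \<bar>lor n (mat_vec n A (kappa n)) (kappa n)\<bar> \<le> C}"
  let ?f = "\<lambda>A. mat_vec n A (kappa n)"
  have "inj_on ?f (Gamma2 n)"
  proof (rule inj_onI)
    fix A B assume AB: "A \<in> Gamma2 n" "B \<in> Gamma2 n" "?f A = ?f B"
    have "mat_vec n (mat_mult n (adj n B) A) (kappa n) = kappa n"
      using AB by simp
    hence "mat_mult n (adj n B) A = idm n"
      using AB kappa_nef_int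
      by (intro Gamma2_nef_int_trivial[OF n, where x = "kappa n"] Gamma2_mult Gamma2_adj) auto
    hence "A = adj n (adj n B)"
      using AB Gamma_lorentzian[of A n]
      by (intro right_inverse_eq_adj) (auto simp: lorentzian_adj lorentzian_def[of n A])
    also have "\<dots> = B"
      using AB by (intro right_inverse_eq_adj[symmetric])
        (auto simp: lorentzian_adj adj_mult_lorentzian intro: Gamma_lorentzian[THEN lorentzian_def[THEN iffD1], THEN conjunct1])
    finally show "A = B" .
  qed
  hence "inj_on ?f ?S" by (rule inj_on_subset) auto
  moreover have "?f ` ?S \<subseteq> {u. int_vec n u \<and> lor n u u \<le> real n - 9 \<and> \<bar>lor n u (kappa n)\<bar> \<le> C}"
    using Gamma_kappa_timelike(1)[OF n(2)] by auto
  hence "finite (?f ` ?S)"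
    using finite_bounded_int_vecs[OF n(2)] by (rule finite_subset)
  ultimately show ?thesis by (rule finite_imageD[rotated])
qed

text \<open>Dirichlet's argument: choose \<open>A\<close> with \<open>A kappa\<close> closest to
  \<open>x\<close>. No reflection in an exceptional vector can improve the choice, and this is
  exactly nefness of the pulled-back point.\<close>

lemma Gamma2_covers:
  assumes n: "2 \<le> n" "n \<le> 7" and x: "x \<in> hyp n"
  shows "\<exists>A\<in>Gamma2 n. mat_vec n (adj n A) x \<in> nef n"
proof -
  let ?f = "\<lambda>A. lor n x (mat_vec n A (kappa n))"
  \<comment> \<open>Only elements at least as good as the identity compete; the triangle-type
    inequality makes them finitely many.\<close>
  define S where "S = {A \<in> Gamma2 n. lor n x (kappa n) \<le> ?f A}"
  have xv: "is_vec n x" "lor n x x = -1" using x by (simp_all add: hyp_def)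
  have "S \<subseteq> {A \<in> Gamma2 n. \<bar>lor n (mat_vec n A (kappa n)) (kappa n)\<bar>
      \<le> 2 * \<bar>lor n (kappa n) x\<bar> * \<bar>lor n (kappa n) x\<bar>}"
  proof
    fix A assume "A \<in> S"
    hence A: "A \<in> Gamma2 n" "lor n x (kappa n) \<le> ?f A" by (auto simp: S_def)
    let ?u = "mat_vec n A (kappa n)"
    have "\<bar>lor n ?u (kappa n)\<bar> \<le> 2 * \<bar>lor n ?u x\<bar> * \<bar>lor n (kappa n) x\<bar>"
      using xv Gamma_kappa_timelike(1)[OF n(2) Gamma2_Gamma[OF A(1)]] n
      by (intro lor_le_twice_product) auto
    also have "\<bar>lor n ?u x\<bar> \<le> \<bar>lor n (kappa n) x\<bar>"
      using A(2) hyp_lor_kappa_neg[OF n(2) x Gamma2_Gamma[OF A(1)]]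
      by (simp add: lor_commute[of n x])
    hence "2 * \<bar>lor n ?u x\<bar> * \<bar>lor n (kappa n) x\<bar> \<le> 2 * \<bar>lor n (kappa n) x\<bar> * \<bar>lor n (kappa n) x\<bar>"
      by (intro mult_right_mono mult_left_mono) auto
    finally show "A \<in> {A \<in> Gamma2 n. \<bar>lor n (mat_vec n A (kappa n)) (kappa n)\<bar>
      \<le> 2 * \<bar>lor n (kappa n) x\<bar> * \<bar>lor n (kappa n) x\<bar>}"
      using A(1) by blast
  qed
  hence "finite S" using Gamma2_kappa_bounded_finite[OF n] by (rule finite_subset)
  moreover have idS: "idm n \<in> S" by (simp add: S_def Gamma2_idm)
  ultimately obtain A where A: "A \<in> S" "\<forall>B\<in>S. ?f B \<le> ?f A"
    using ex_finite_max_on[of ?f S] by blast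
  have AG: "A \<in> Gamma2 n" using A by (simp add: S_def)
  have max: "?f B \<le> ?f A" if "B \<in> Gamma2 n" for B
    using A that by (cases "B \<in> S") (auto simp: S_def)
  have "lor n (mat_vec n (adj n A) x) e \<le> 0" if e: "e \<in> exceptional n" for e
  proof -
    note E = exceptionalD[OF e]
    \<comment> \<open>The reflection takes \<open>kappa\<close> to \<open>kappa + 2 e\<close>, so
      comparing this element with \<open>A\<close> isolates the product with
      \<open>e\<close>.\<close>
    have "mat_mult n A (lin_refl n 2 e) \<in> Gamma2 n"
      using AG E by (intro Gamma2_mult Gamma2_lin_refl)
    from max[OF this] have "lor n (mat_vec n (adj n A) x) (refl_vec n 2 e (kappa n))
        \<le> lor n (mat_vec n (adj n A) x) (kappa n)"
      using E by (simp add: mat_vec_lin_refl lor_mat_vec_right)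
    thus ?thesis
      using E by (simp add: refl_vec_def lor_commute[of n "kappa n" e])
  qed
  hence "mat_vec n (adj n A) x \<in> nef n" by (simp add: nef_def)
  thus ?thesis using AG by blast
qed

section \<open>Interiors, closures and sides\<close>

text \<open>Radial projection of a future time-like vector to the hyperboloid; it keeps the signs of
  all products.\<close>

definition normalize :: "nat \<Rightarrow> (nat \<Rightarrow> real) \<Rightarrow> nat \<Rightarrow> real" where
  "normalize n z = lc (1 / sqrt (- lor n z z)) z 0 z"

lemma lor_normalize: "lor n (normalize n z) e = lor n z e / sqrt (- lor n z z)"
  by (simp add: normalize_def)

lemma hyp_normalize:
  assumes "is_vec n z" "lor n z z < 0" "z (n+1) > 0" shows "normalize n z \<in> hyp n"
proof -
  have "lor n (normalize n z) (normalize n z) = lor n z z / (sqrt (- lor n z z) * sqrt (- lor n z z))"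
    by (simp add: lor_normalize lor_commute[of n z "normalize n z"])
  hence "lor n (normalize n z) (normalize n z) = -1" using assms by simp
  moreover have "normalize n z (n+1) > 0" using assms by (simp add: normalize_def lc_def)
  moreover have "is_vec n (normalize n z)" using assms by (simp add: normalize_def)
  ultimately show ?thesis by (simp add: hyp_def)
qed

lemma hypD:
  assumes "x \<in> hyp n" shows "is_vec n x" "lor n x x = -1" "x (n+1) > 0"
  using assms by (simp_all add: hyp_def)

text \<open>Supplies test points for interiors, closures and sides: cosh of the distance from
  \<open>x\<close> to the projected point is \<open>(1 - s * <x,u>) / sqrt (q s)\<close>, which
  tends to 1 with \<open>s \<rightarrow> 0\<close>.\<close>

lemma hyp_perturb:
  assumes x: "x \<in> hyp n" and u: "is_vec n u" and eps: "\<epsilon> > 0"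
  shows "\<exists>d>0. \<forall>s. s \<noteq> 0 \<and> \<bar>s\<bar> < d \<longrightarrow> lor n (lc 1 x s u) (lc 1 x s u) < 0 \<and>
      normalize n (lc 1 x s u) \<in> hyp n \<and> - lor n x (normalize n (lc 1 x s u)) < 1 + \<epsilon>"
proof -
  note X = hypD[OF x]
  define q where "q s = - lor n (lc 1 x s u) (lc 1 x s u)" for s
  have q: "q = (\<lambda>s. 1 - s * (2 * lor n x u) - s * s * lor n u u)"
    by (rule ext) (simp add: q_def X lor_commute[of n u x] algebra_simps)
  have "(q \<longlongrightarrow> 1 - 0 * (2 * lor n x u) - 0 * 0 * lor n u u) (at 0)"
    unfolding q by (intro tendsto_intros)
  hence q1: "(q \<longlongrightarrow> 1) (at 0)" by simp
  have "((\<lambda>s. x (n+1) + s * u (n+1)) \<longlongrightarrow> x (n+1) + 0 * u (n+1)) (at 0)"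
    by (intro tendsto_intros)
  hence t1: "((\<lambda>s. x (n+1) + s * u (n+1)) \<longlongrightarrow> x (n+1)) (at 0)" by simp
  have "((\<lambda>s. (1 - s * lor n x u) / sqrt (q s)) \<longlongrightarrow> (1 - 0 * lor n x u) / sqrt 1) (at 0)"
    by (intro tendsto_intros q1) auto
  hence d1: "((\<lambda>s. (1 - s * lor n x u) / sqrt (q s)) \<longlongrightarrow> 1) (at 0)" by simp
  have "eventually (\<lambda>s. q s > 0) (at 0)"
    using order_tendstoD(1)[OF q1, of 0] by simp
  moreover have "eventually (\<lambda>s. x (n+1) + s * u (n+1) > 0) (at 0)"
    using order_tendstoD(1)[OF t1, of 0] X(3) by simp
  moreover have "eventually (\<lambda>s. (1 - s * lor n x u) / sqrt (q s) < 1 + \<epsilon>) (at 0)"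
    using order_tendstoD(2)[OF d1, of "1 + \<epsilon>"] eps by simp
  ultimately have "eventually (\<lambda>s. q s > 0 \<and> x (n+1) + s * u (n+1) > 0 \<and>
      (1 - s * lor n x u) / sqrt (q s) < 1 + \<epsilon>) (at 0)"
    by eventually_elim blast
  then obtain d where d: "d > 0" "\<And>s. s \<noteq> 0 \<Longrightarrow> \<bar>s\<bar> < d \<Longrightarrow> q s > 0 \<and> x (n+1) + s * u (n+1) > 0 \<and>
      (1 - s * lor n x u) / sqrt (q s) < 1 + \<epsilon>"
    unfolding eventually_at by (auto simp: dist_real_def)
  show ?thesis
  proof (intro exI conjI allI impI)
    fix s assume "s \<noteq> 0 \<and> \<bar>s\<bar> < d"
    hence s: "q s > 0" "x (n+1) + s * u (n+1) > 0" "(1 - s * lor n x u) / sqrt (q s) < 1 + \<epsilon>"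
      using d(2)[of s] by auto
    let ?z = "lc 1 x s u"
    show neg: "lor n ?z ?z < 0" using s(1) by (simp only: q_def)
    show "normalize n ?z \<in> hyp n"
      using X u s(2) by (intro hyp_normalize neg) (simp, simp add: lc_def)
    have "- lor n x (normalize n ?z) = (1 - s * lor n x u) / sqrt (q s)"
      unfolding lor_commute[of n x "normalize n ?z"] lor_normalize q_def
      by (simp add: X lor_commute[of n u x] minus_divide_left)
    thus "- lor n x (normalize n ?z) < 1 + \<epsilon>" using s(3) by simp
  qed (rule d(1))
qed

lemma hyp_lor_ge1:
  assumes "x \<in> hyp n" "y \<in> hyp n" shows "- lor n x y \<ge> 1"
proof -
  note X = hypD[OF assms(1)] and Y = hypD[OF assms(2)]
  let ?c = "lc 1 y (lor n x y) x"
  have "0 \<le> lor n ?c ?c"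
    using X by (intro time_orthogonal_nonneg[of n x]) (auto simp: lor_commute[of n y x])
  also have "lor n ?c ?c = (- lor n x y)\<^sup>2 - 1"
    using X Y by (simp add: lor_commute[of n y x] power2_eq_square algebra_simps)
  finally have "1\<^sup>2 \<le> (- lor n x y)\<^sup>2" by simp
  moreover have "lor n x y < 0"
    using X Y by (subst timelike_same_sheet) auto
  ultimately show ?thesis
    using power2_le_imp_le[of 1 "- lor n x y"] by simp
qed

text \<open>Open half-spaces are open in the cosh metric: if \<open><y,e> \<ge> 0\<close>, reverse
  Cauchy-Schwarz gives \<open>a^2 \<le> (c^2 - 1) * K\<close> with \<open>c = - <x,y>\<close>, which
  fails for \<open>c\<close> near 1.\<close>

lemma hyp_near_negative:
  assumes x: "x \<in> hyp n" and e: "is_vec n e" and neg: "lor n x e < 0"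
  shows "\<exists>\<epsilon>>0. \<forall>y\<in>hyp n. - lor n x y < 1 + \<epsilon> \<longrightarrow> lor n y e < 0"
proof -
  note X = hypD[OF x]
  define a K where "a = - lor n x e" and "K = lor n e e + (lor n x e)\<^sup>2"
  have a: "a > 0" using neg by (simp add: a_def)
  have K: "K \<ge> 0"
  proof -
    let ?c = "lc 1 e (lor n x e) x"
    have "0 \<le> lor n ?c ?c"
      using X by (intro time_orthogonal_nonneg[of n x]) (auto simp: lor_commute[of n e x])
    also have "lor n ?c ?c = K"
      using X by (simp add: K_def lor_commute[of n e x] power2_eq_square algebra_simps)
    finally show ?thesis .
  qed
  \<comment> \<open>The bound 1 yields \<open>c^2 - 1 \<le> 3 * \<epsilon>\<close>; using
    \<open>K + 1\<close> for \<open>K\<close> avoids a zero denominator and makes the final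
    contradiction strict.\<close>
  define \<epsilon> where "\<epsilon> = min 1 (a\<^sup>2 / (3 * (K + 1)))"
  have eps: "\<epsilon> > 0" "\<epsilon> \<le> 1" "\<epsilon> \<le> a\<^sup>2 / (3 * (K + 1))" using a K by (auto simp: \<epsilon>_def)
  have epsK: "3 * \<epsilon> * (K + 1) \<le> a\<^sup>2"
    using eps(3) K by (simp add: field_simps)
  have "lor n y e < 0" if y: "y \<in> hyp n" "- lor n x y < 1 + \<epsilon>" for y
  proof (rule ccontr)
    assume "\<not> lor n y e < 0"
    hence b: "lor n y e \<ge> 0" by simp
    note Y = hypD[OF y(1)]
    define c where "c = - lor n x y"
    have c: "c \<ge> 1" "c < 1 + \<epsilon>" using hyp_lor_ge1[OF x y(1)] y(2) by (simp_all add: c_def)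
    have "(lor n y e * lor n x x - lor n y x * lor n e x)\<^sup>2
        \<le> (lor n y y * lor n x x - (lor n y x)\<^sup>2) * (lor n e e * lor n x x - (lor n e x)\<^sup>2)"
      using X e by (intro lor_reverse_Cauchy_Schwarz) auto
    hence "(lor n y e + c * a)\<^sup>2 \<le> (c\<^sup>2 - 1) * K"
      using X Y by (simp add: c_def a_def K_def lor_commute[of n y x] lor_commute[of n e x]
          power2_eq_square algebra_simps)
    moreover have "a \<le> lor n y e + c * a" using mult_right_mono[of 1 c a] c a b by linarith
    hence "a\<^sup>2 \<le> (lor n y e + c * a)\<^sup>2" using a by (intro power_mono) auto
    moreover have "(c\<^sup>2 - 1) * K \<le> 3 * \<epsilon> * K"
    proof (rule mult_right_mono[OF _ K])
      have "c\<^sup>2 \<le> (1 + \<epsilon>)\<^sup>2" using c by (intro power_mono) auto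
      moreover have "(1 + \<epsilon>)\<^sup>2 = 1 + 2 * \<epsilon> + \<epsilon> * \<epsilon>" by (simp add: power2_eq_square algebra_simps)
      moreover have "\<epsilon> * \<epsilon> \<le> 1 * \<epsilon>" using eps by (intro mult_right_mono) auto
      ultimately show "c\<^sup>2 - 1 \<le> 3 * \<epsilon>" by linarith
    qed
    moreover have "3 * \<epsilon> * (K + 1) = 3 * \<epsilon> * K + 3 * \<epsilon>" by (simp add: algebra_simps)
    ultimately show False using epsK eps(1) by linarith
  qed
  thus ?thesis using eps(1) by blast
qed

lemma finite_exceptional: "n \<le> 7 \<Longrightarrow> finite (exceptional n)"
  by (rule finite_subset[OF _ finite_bounded_int_vecs[of n 1 1]]) (auto simp: exceptional_def)

lemma finite_uniform_eps:
  fixes c :: "'a \<Rightarrow> real"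
  assumes "finite S" "\<And>e. e \<in> S \<Longrightarrow> \<exists>\<epsilon>>0. \<forall>y\<in>M. c y < 1 + \<epsilon> \<longrightarrow> P e y"
  shows "\<exists>\<epsilon>>0. \<forall>y\<in>M. c y < 1 + \<epsilon> \<longrightarrow> (\<forall>e\<in>S. P e y)"
  using assms
proof (induction S rule: finite_induct)
  case empty
  show ?case by (intro exI[of _ 1]) auto
next
  case (insert e S)
  obtain \<epsilon>1 where 1: "\<epsilon>1 > 0" "\<forall>y\<in>M. c y < 1 + \<epsilon>1 \<longrightarrow> P e y" using insert.prems by blast
  obtain \<epsilon>2 where 2: "\<epsilon>2 > 0" "\<forall>y\<in>M. c y < 1 + \<epsilon>2 \<longrightarrow> (\<forall>e\<in>S. P e y)"
    using insert.IH insert.prems by blast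
  show ?case using 1 2 by (intro exI[of _ "min \<epsilon>1 \<epsilon>2"]) auto
qed

text \<open>From a point on a wall a small move along its normal leaves the cone; conversely
  finitely many strict inequalities persist nearby.\<close>

lemma h_int_hyp_nef:
  assumes n: "n \<le> 7" shows "h_int n (hyp n) (hyp n \<inter> nef n) = hyp n \<inter> nef_int n"
proof (intro equalityI subsetI)
  fix x assume "x \<in> h_int n (hyp n) (hyp n \<inter> nef n)"
  then obtain \<epsilon> where x: "x \<in> hyp n" "x \<in> nef n" "\<epsilon> > 0"
    "\<And>y. y \<in> hyp n \<Longrightarrow> - lor n x y < 1 + \<epsilon> \<Longrightarrow> y \<in> nef n"
    by (auto simp: h_int_def)
  have "lor n x e < 0" if e: "e \<in> exceptional n" for e
  proof (rule ccontr)
    assume "\<not> lor n x e < 0"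
    hence 0: "lor n x e = 0" using x(2) e by (force simp: nef_def)
    note E = exceptionalD[OF e]
    obtain d where d: "d > 0" "\<And>s. s \<noteq> 0 \<Longrightarrow> \<bar>s\<bar> < d \<Longrightarrow> lor n (lc 1 x s e) (lc 1 x s e) < 0 \<and>
      normalize n (lc 1 x s e) \<in> hyp n \<and> - lor n x (normalize n (lc 1 x s e)) < 1 + \<epsilon>"
      using hyp_perturb[OF x(1) E(2) x(3)] by blast
    let ?z = "lc 1 x (d/2) e"
    have z: "lor n ?z ?z < 0" "normalize n ?z \<in> nef n"
      using d(1) d(2)[of "d/2"] x(4) by auto
    have "lor n (normalize n ?z) e > 0"
      unfolding lor_normalize using z(1) d(1) by (intro divide_pos_pos) (simp_all add: 0 E(3))
    thus False using z(2) e by (force simp: nef_def)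
  qed
  thus "x \<in> hyp n \<inter> nef_int n" using x by (simp add: nef_int_def hyp_def)
next
  fix x assume x: "x \<in> hyp n \<inter> nef_int n"
  hence "\<exists>\<epsilon>>0. \<forall>y\<in>hyp n. - lor n x y < 1 + \<epsilon> \<longrightarrow> (\<forall>e\<in>exceptional n. lor n y e < 0)"
    using exceptionalD(2)
    by (intro finite_uniform_eps[OF finite_exceptional[OF n]] hyp_near_negative) (auto simp: nef_int_def)
  then obtain \<epsilon> where eps: "\<epsilon> > 0"
    "\<And>y e. y \<in> hyp n \<Longrightarrow> - lor n x y < 1 + \<epsilon> \<Longrightarrow> e \<in> exceptional n \<Longrightarrow> lor n y e < 0"
    by blast
  have "y \<in> nef n" if y: "y \<in> hyp n" "- lor n x y < 1 + \<epsilon>" for y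
    unfolding nef_def using hypD(1)[OF y(1)] eps(2)[OF y] by (simp add: less_imp_le)
  thus "x \<in> h_int n (hyp n) (hyp n \<inter> nef n)"
    using x nef_int_nef[of x n] eps(1) unfolding h_int_def by blast
qed

text \<open>Moving a nef point slightly in the direction of \<open>kappa\<close> makes all
  inequalities strict.\<close>

lemma h_closure_nef_int:
  shows "h_closure n (hyp n \<inter> nef_int n) = hyp n \<inter> nef n"
proof (intro equalityI subsetI)
  fix x assume "x \<in> h_closure n (hyp n \<inter> nef_int n)"
  hence x: "x \<in> hyp n" "\<And>\<epsilon>. \<epsilon> > 0 \<Longrightarrow> \<exists>y\<in>hyp n \<inter> nef_int n. - lor n x y < 1 + \<epsilon>"
    by (auto simp: h_closure_def)
  have "lor n x e \<le> 0" if e: "e \<in> exceptional n" for e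
  proof (rule ccontr)
    assume "\<not> lor n x e \<le> 0"
    moreover note E = exceptionalD[OF e]
    ultimately obtain \<epsilon> where "\<epsilon> > 0"
      "\<forall>y\<in>hyp n. - lor n x y < 1 + \<epsilon> \<longrightarrow> lor n y (lc (-1) e 0 e) < 0"
      using hyp_near_negative[OF x(1), of "lc (-1) e 0 e"] by auto
    thus False using x(2)[of \<epsilon>] e by (force simp: nef_int_def)
  qed
  thus "x \<in> hyp n \<inter> nef n" using x(1) by (simp add: nef_def hyp_def)
next
  fix x assume x: "x \<in> hyp n \<inter> nef n"
  have "\<exists>y\<in>hyp n \<inter> nef_int n. - lor n x y < 1 + \<epsilon>" if eps: "\<epsilon> > 0" for \<epsilon>
  proof -
    have "x \<in> hyp n" using x by simp
    from hyp_perturb[OF this is_vec_kappa eps]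
    obtain d where d: "d > 0" "\<And>s. s \<noteq> 0 \<Longrightarrow> \<bar>s\<bar> < d \<Longrightarrow>
        lor n (lc 1 x s (kappa n)) (lc 1 x s (kappa n)) < 0 \<and>
        normalize n (lc 1 x s (kappa n)) \<in> hyp n \<and>
        - lor n x (normalize n (lc 1 x s (kappa n))) < 1 + \<epsilon>"
      by blast
    let ?z = "lc 1 x (d/2) (kappa n)"
    have z: "lor n ?z ?z < 0" "normalize n ?z \<in> hyp n" "- lor n x (normalize n ?z) < 1 + \<epsilon>"
      using d(1) d(2)[of "d/2"] by auto
    have "lor n (normalize n ?z) e < 0" if e: "e \<in> exceptional n" for e
    proof -
      have "lor n x e \<le> 0" using x e by (simp add: nef_def)
      moreover have "lor n (kappa n) e = -1"
        using exceptionalD(4)[OF e] by (simp add: lor_commute[of n "kappa n" e])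
      ultimately have "lor n ?z e < 0" using d(1) by simp
      moreover have "0 < sqrt (- lor n ?z ?z)"
        using z(1) by (simp only: real_sqrt_gt_0_iff neg_0_less_iff_less)
      ultimately show ?thesis
        unfolding lor_normalize by (rule divide_neg_pos)
    qed
    thus ?thesis using z(2,3) by (intro bexI[of _ "normalize n ?z"]) (auto simp: nef_int_def hyp_def)
  qed
  thus "x \<in> h_closure n (hyp n \<inter> nef_int n)" using x by (simp add: h_closure_def)
qed

text \<open>The difference \<open>e - f\<close> is nonzero and orthogonal to \<open>kappa\<close>,
  so its norm \<open>2 - 2 * <e,f>\<close> is positive.\<close>

lemma lor_exceptional_less_1:
  assumes "n \<le> 7" "e \<in> exceptional n" "f \<in> exceptional n" "e \<noteq> f" shows "lor n e f < 1"
proof -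
  note E = exceptionalD[OF assms(2)] and F = exceptionalD[OF assms(3)]
  let ?d = "lc 1 e (-1) f"
  have k: "lor n ?d (kappa n) = 0" by (simp add: E F)
  have "lor n ?d ?d \<noteq> 0"
  proof
    assume "lor n ?d ?d = 0"
    hence "?d = (\<lambda>_. 0)"
      using E F by (intro time_orthogonal_null[OF kappa_timelike[OF assms(1)] k]) auto
    hence "e i - f i = 0" for i by (simp add: lc_def fun_eq_iff)
    thus False using assms(4) by (simp add: fun_eq_iff)
  qed
  hence "0 < lor n ?d ?d"
    using time_orthogonal_nonneg[OF kappa_timelike[OF assms(1)] k] by simp
  thus ?thesis by (simp add: E F lor_commute[of n f e])
qed

lemma side_normals_eq:
  assumes n: "2 \<le> n" "n \<le> 7" shows "side_normals n (hyp n \<inter> nef n) = exceptional n"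
proof (intro equalityI subsetI)
  fix e assume e: "e \<in> exceptional n"
  note E = exceptionalD[OF e]
  have ke: "lor n (kappa n) e = -1" using E(4) by (simp add: lor_commute[of n "kappa n" e])
  \<comment> \<open>The projection of \<open>kappa\<close> to the wall of \<open>e\<close>. Its
    product with any other \<open>f\<close> is \<open>-1 + <e,f> < 0\<close>, so it lies in the
    relative interior of the side.\<close>
  let ?z = "lc 1 (kappa n) 1 e"
  have zz: "lor n ?z ?z < 0" using n by (simp add: E ke)
  have "lor n (kappa n) ?z < 0" using n by (simp add: ke)
  hence "?z (n+1) > 0"
    using timelike_same_sheet[of n "kappa n" ?z] zz n by simp
  hence zh: "normalize n ?z \<in> hyp n" using E zz by (intro hyp_normalize) auto
  let ?x = "normalize n ?z"
  have x0: "lor n ?x e = 0" unfolding lor_normalize by (simp add: E ke)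
  have xf: "lor n ?x f < 0" if f: "f \<in> exceptional n - {e}" for f
  proof -
    have "lor n (kappa n) f = -1"
      using f exceptionalD(4)[of f n] by (simp add: lor_commute[of n "kappa n" f])
    moreover have "lor n e f < 1" using lor_exceptional_less_1[OF n(2) e] f by blast
    ultimately show ?thesis
      unfolding lor_normalize using zz by (intro divide_neg_pos) auto
  qed
  have "\<exists>\<epsilon>>0. \<forall>y\<in>hyp n. - lor n ?x y < 1 + \<epsilon> \<longrightarrow> (\<forall>f\<in>exceptional n - {e}. lor n y f < 0)"
    using exceptionalD(2) finite_exceptional[OF n(2)] xf
    by (intro finite_uniform_eps hyp_near_negative[OF zh]) auto
  then obtain \<epsilon> where eps: "\<epsilon> > 0"
    "\<And>y f. y \<in> hyp n \<Longrightarrow> - lor n ?x y < 1 + \<epsilon> \<Longrightarrow> f \<in> exceptional n - {e} \<Longrightarrow> lor n y f < 0"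
    by blast
  have near: "y \<in> nef n" if y: "y \<in> hyp n" "lor n y e = 0" "- lor n ?x y < 1 + \<epsilon>" for y
    unfolding nef_def
  proof (intro CollectI conjI ballI)
    show "is_vec n y" using y(1) by (simp add: hyp_def)
    fix f assume "f \<in> exceptional n"
    thus "lor n y f \<le> 0" using eps(2)[OF y(1,3), of f] y(2) by (cases "f = e") auto
  qed
  have "?x \<in> nef n" using near[OF zh x0] hypD(2)[OF zh] eps(1) by simp
  hence "?x \<in> h_int n (hyp n \<inter> {y. lor n y e = 0}) (hyp n \<inter> nef n \<inter> {y. lor n y e = 0})"
    using zh x0 near eps(1) unfolding h_int_def by blast
  thus "e \<in> side_normals n (hyp n \<inter> nef n)"
    using E e by (auto simp: side_normals_def nef_def)
next
  fix e assume "e \<in> side_normals n (hyp n \<inter> nef n)"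
  then obtain x \<epsilon> where e: "is_vec n e" "lor n e e = 1" "\<And>x. x \<in> hyp n \<Longrightarrow> x \<in> nef n \<Longrightarrow> lor n x e \<le> 0"
    and x: "x \<in> hyp n" "x \<in> nef n" "lor n x e = 0" "\<epsilon> > 0"
    "\<And>y. y \<in> hyp n \<Longrightarrow> lor n y e = 0 \<Longrightarrow> - lor n x y < 1 + \<epsilon> \<Longrightarrow> y \<in> nef n"
    unfolding side_normals_def h_int_def by blast
  \<comment> \<open>Otherwise a small move along \<open>e\<close> would stay in the nef cone and yet
    cross the supporting hyperplane.\<close>
  have "x \<notin> nef_int n"
  proof
    assume "x \<in> nef_int n"
    hence "x \<in> h_int n (hyp n) (hyp n \<inter> nef n)" using x(1) h_int_hyp_nef[OF n(2)] by blast
    then obtain \<delta> where \<delta>: "\<delta> > 0" "\<And>y. y \<in> hyp n \<Longrightarrow> - lor n x y < 1 + \<delta> \<Longrightarrow> y \<in> nef n"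
      by (auto simp: h_int_def)
    obtain d where d: "d > 0" "\<And>s. s \<noteq> 0 \<Longrightarrow> \<bar>s\<bar> < d \<Longrightarrow> lor n (lc 1 x s e) (lc 1 x s e) < 0 \<and>
      normalize n (lc 1 x s e) \<in> hyp n \<and> - lor n x (normalize n (lc 1 x s e)) < 1 + \<delta>"
      using hyp_perturb[OF x(1) e(1) \<delta>(1)] by blast
    let ?z = "lc 1 x (d/2) e"
    have z: "lor n ?z ?z < 0" "normalize n ?z \<in> hyp n" "normalize n ?z \<in> nef n"
      using d(1) d(2)[of "d/2"] \<delta>(2) by auto
    have "lor n (normalize n ?z) e > 0"
      unfolding lor_normalize using z(1) d(1) by (intro divide_pos_pos) (simp_all add: x(3) e(2))
    thus False using e(3)[OF z(2,3)] by simp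
  qed
  then obtain f where f: "f \<in> exceptional n" "lor n x f = 0"
    using x(2) by (force simp: nef_def nef_int_def)
  note F = exceptionalD[OF f(1)]
  \<comment> \<open>The projection of the wall normal \<open>f\<close> to the complement of
    \<open>e\<close>. A move along \<open>u\<close> stays in the side but raises the product with
    \<open>f\<close> unless \<open>u = 0\<close>; so \<open>f\<close> is a multiple of
    \<open>e\<close>.\<close>
  define u where "u = lc 1 f (- lor n f e) e"
  have u: "is_vec n u" "lor n u e = 0" "lor n x u = 0" "lor n u f = lor n u u"
    using F e x(3) f(2) by (auto simp: u_def lor_commute[of n e f] algebra_simps)
  obtain d where d: "d > 0" "\<And>s. s \<noteq> 0 \<Longrightarrow> \<bar>s\<bar> < d \<Longrightarrow> lor n (lc 1 x s u) (lc 1 x s u) < 0 \<and>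
      normalize n (lc 1 x s u) \<in> hyp n \<and> - lor n x (normalize n (lc 1 x s u)) < 1 + \<epsilon>"
    using hyp_perturb[OF x(1) u(1) x(4)] by blast
  let ?z = "lc 1 x (d/2) u"
  have z: "lor n ?z ?z < 0" "normalize n ?z \<in> hyp n" "- lor n x (normalize n ?z) < 1 + \<epsilon>"
    using d(1) d(2)[of "d/2"] by auto
  have "lor n (normalize n ?z) e = 0" unfolding lor_normalize by (simp add: x(3) u(2))
  hence "normalize n ?z \<in> nef n" using x(5) z by blast
  hence "lor n (normalize n ?z) f \<le> 0" using f(1) by (simp add: nef_def)
  hence "lor n u u \<le> 0"
    unfolding lor_normalize using z(1) d(1) u(4) f(2) by (simp add: divide_le_0_iff mult_le_0_iff)
  moreover have xneg: "lor n x x < 0" and ux: "lor n u x = 0"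
    using hypD(2)[OF x(1)] u(3) by (simp_all add: lor_commute[of n u x])
  ultimately have "lor n u u = 0" using time_orthogonal_nonneg[OF xneg ux] by simp
  hence "u = (\<lambda>_. 0)" using time_orthogonal_null[OF xneg ux] u(1) by blast
  hence fe: "f i = lor n f e * e i" for i by (simp add: u_def lc_def fun_eq_iff)
  have "lor n f f = lor n f e * lor n f e"
  proof -
    have "f = lc (lor n f e) e 0 e" using fe by (simp add: lc_def fun_eq_iff)
    hence "lor n f f = lor n f (lc (lor n f e) e 0 e)" by metis
    thus ?thesis by simp
  qed
  hence "lor n f e = 1 \<or> lor n f e = -1" using F(3) by (metis square_eq_1_iff)
  \<comment> \<open>If \<open>e = - f\<close>, the interior point over \<open>kappa\<close> would
    lie on the wrong side of \<open>e\<close>.\<close>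
  moreover have "lor n f e \<noteq> -1"
  proof
    assume "lor n f e = -1"
    hence "e = lc (-1) f 0 f" using fe by (simp add: lc_def fun_eq_iff)
    hence "lor n (normalize n (kappa n)) e = - lor n (normalize n (kappa n)) f" by simp
    moreover have "normalize n (kappa n) \<in> hyp n"
      using n by (intro hyp_normalize) auto
    moreover have neg: "lor n (normalize n (kappa n)) g < 0" if "g \<in> exceptional n" for g
      unfolding lor_normalize using n that kappa_nef_int[of n]
      by (intro divide_neg_pos) (auto simp: nef_int_def)
    moreover have "is_vec n (normalize n (kappa n))" by (simp add: normalize_def)
    ultimately show False using e(3)[of "normalize n (kappa n)"] neg[OF f(1)]
      by (force simp: nef_def)
  qed
  ultimately have "e = f" using fe by (simp add: fun_eq_iff)
  thus "e \<in> exceptional n" using f(1) by simp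
qed

section \<open>The polytope\<close>

text \<open>With time coordinate \<open>- t \<le> 0\<close> the spatial sum would be below
  \<open>- 3 * t\<close>, so its square would exceed the upper bound \<open>7 * t^2\<close>.\<close>

lemma nonspacelike_future:
  assumes n: "n \<le> 7" and u: "lor n u u \<le> 0" "lor n u (kappa n) < 0" shows "u (n+1) > 0"
proof (rule ccontr)
  assume "\<not> u (n+1) > 0"
  define t S where "t = - u (n+1)" and "S = - (\<Sum>i=1..n. u i)"
  have t: "0 \<le> t" using \<open>\<not> u (n+1) > 0\<close> by (simp add: t_def)
  have S: "3 * t < S" using u(2) unfolding lor_kappa by (simp add: t_def S_def)
  have "S\<^sup>2 \<le> 7 * (\<Sum>i=1..n. u i * u i)" using sum_square_le[OF n, of u] by (simp add: S_def)
  also have "(\<Sum>i=1..n. u i * u i) \<le> t * t" using u(1) by (simp add: lor_def t_def)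
  hence "7 * (\<Sum>i=1..n. u i * u i) \<le> 7 * (t * t)" by simp
  also have "\<dots> \<le> (3 * t)\<^sup>2" by (simp add: power2_eq_square)
  also have "\<dots> < S\<^sup>2" using S t by (intro power_strict_mono) auto
  finally show False by simp
qed

lemma lor_vtx_kappa:
  assumes "k \<le> n" "n \<le> 7" shows "-6 \<le> lor n (vtx n k) (kappa n)" "lor n (vtx n k) (kappa n) < 0"
proof -
  have "(\<Sum>i=1..k. kappa n i) = (\<Sum>i=1..k. 1)"
    using assms by (intro sum.cong) (auto simp: kappa_def)
  hence "lor n (vtx n k) (kappa n) = (if k = 0 then -3 else real k - 3 * real (min k 3))"
    using assms by (simp add: lor_vtx)
  thus "-6 \<le> lor n (vtx n k) (kappa n)" "lor n (vtx n k) (kappa n) < 0"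
    using assms by (auto simp: min_def)
qed

lemma mat_vec_sum:
  "mat_vec n A (\<lambda>i. \<Sum>k\<in>K. a k * w k i) = (\<lambda>i. \<Sum>k\<in>K. a k * mat_vec n A (w k) i)"
proof
  fix i
  have "(\<Sum>j=1..n+1. A i j * (\<Sum>k\<in>K. a k * w k j)) = (\<Sum>k\<in>K. a k * (\<Sum>j=1..n+1. A i j * w k j))"
    unfolding sum_distrib_left by (subst sum.swap) (simp add: mult_ac)
  thus "mat_vec n A (\<lambda>i. \<Sum>k\<in>K. a k * w k i) i = (\<Sum>k\<in>K. a k * mat_vec n A (w k) i)"
    unfolding mat_vec_def by (cases "i \<in> {1..n+1}") (simp_all only: if_True if_False mult_zero_right sum.neutral_const)
qed

text \<open>Any finite nef set containing the translates of the vertices serves, as further nef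
  members do not enlarge the hull. The bound 6 comes from \<open>lor_vtx_kappa\<close> and is
  reached at vertex 3.\<close>

definition vertex_set :: "nat \<Rightarrow> (nat \<Rightarrow> real) set" where
  "vertex_set n = {u \<in> nef n. int_vec n u \<and> lor n u u \<le> 0 \<and> u (n+1) > 0 \<and> \<bar>lor n u (kappa n)\<bar> \<le> 6}"

lemma stabilizer_vtx_vertex_set:
  assumes n: "2 \<le> n" "n \<le> 7" and A: "A \<in> kappa_stabilizer n" and k: "k \<le> n"
  shows "mat_vec n A (vtx n k) \<in> vertex_set n"
proof -
  let ?u = "mat_vec n A (vtx n k)"
  have G: "A \<in> Gamma n" "mat_vec n A (kappa n) = kappa n"
    using A by (simp_all add: kappa_stabilizer_def)
  note I = int_vec_vtx[OF k]
  have "?u \<in> nef n"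
    using nef_stabilizer[OF A] vtx_dcone[OF _ k] dcone_subset_nef[of n] n by auto
  moreover have "int_vec n ?u" using G(1) I by (rule Gamma_int_vec)
  moreover have uu: "lor n ?u ?u \<le> 0"
    using lor_vtx_vtx[OF k k n(2)] I G by (simp add: lorentzian_lor)
  moreover have "lor n ?u (kappa n) = lor n (vtx n k) (kappa n)"
    using lorentzian_lor[of n A "vtx n k" "kappa n"] G I by simp
  hence uk: "-6 \<le> lor n ?u (kappa n)" "lor n ?u (kappa n) < 0"
    using lor_vtx_kappa[OF k n(2)] by simp_all
  moreover have "?u (n+1) > 0" using nonspacelike_future[OF n(2) uu uk(2)] .
  ultimately show ?thesis by (simp add: vertex_set_def)
qed

lemma normalize_kappa:
  assumes "n \<le> 7" shows "normalize n (kappa n) \<in> hyp n \<inter> nef_int n"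
proof -
  have "lor n (normalize n (kappa n)) e < 0" if "e \<in> exceptional n" for e
    unfolding lor_normalize using assms that kappa_nef_int[of n]
    by (intro divide_neg_pos) (auto simp: nef_int_def)
  moreover have "normalize n (kappa n) \<in> hyp n"
    using assms by (intro hyp_normalize) auto
  ultimately show ?thesis by (simp add: nef_int_def hyp_def)
qed

lemma polytope_nef:
  assumes n: "2 \<le> n" "n \<le> 7" shows "polytope n (hyp n \<inter> nef n)"
proof -
  let ?V = "vertex_set n"
  have fin: "finite ?V"
    by (rule finite_subset[OF _ finite_bounded_int_vecs[OF n(2), of 0 6]]) (auto simp: vertex_set_def)
  have "hyp n \<inter> nef n = {x \<in> hyp n. \<exists>c. (\<forall>v\<in>?V. c v \<ge> 0) \<and> x = (\<lambda>i. \<Sum>v\<in>?V. c v * v i)}"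
  proof (intro equalityI subsetI)
    fix x assume x: "x \<in> hyp n \<inter> nef n"
    then obtain g where g: "g \<in> SigmaG n" "mat_vec n g x \<in> dcone n"
      using nef_to_dcone[OF n] by blast
    have stab: "g \<in> kappa_stabilizer n" using SigmaG_subset_stabilizer[OF n(1)] g(1) by blast
    define w where "w k = mat_vec n (adj n g) (vtx n k)" for k
    define a where "a = dcoeff n (mat_vec n g x)"
    have w: "w k \<in> ?V" if "k \<in> {0..n}" for k
      unfolding w_def using that by (intro stabilizer_vtx_vertex_set[OF n] kappa_stabilizer_adj stab) simp
    have a: "0 \<le> a k" if "k \<in> {0..n}" for k
      unfolding a_def using that by (intro dcoeff_nonneg[OF g(2)]) simp
    have "x = mat_vec n (adj n g) (mat_vec n g x)"
      using stab x by (simp add: kappa_stabilizer_def hyp_def)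
    also have "mat_vec n g x = (\<lambda>i. \<Sum>k=0..n. a k * vtx n k i)"
      unfolding a_def using n by (intro dcone_decomp) auto
    finally have xs: "x = (\<lambda>i. \<Sum>k=0..n. a k * w k i)"
      unfolding w_def mat_vec_sum .
    \<comment> \<open>Summing over the fibres of \<open>w\<close> avoids proving \<open>w\<close>
      injective.\<close>
    define c where "c v = (\<Sum>k\<in>{k\<in>{0..n}. w k = v}. a k)" for v
    have "(\<Sum>v\<in>?V. c v * v i) = (\<Sum>k=0..n. a k * w k i)" for i
    proof -
      have "(\<Sum>v\<in>?V. c v * v i) = (\<Sum>v\<in>?V. \<Sum>k\<in>{k\<in>{0..n}. w k = v}. a k * w k i)"
        unfolding c_def sum_distrib_right by (intro sum.cong) auto
      also have "\<dots> = (\<Sum>k=0..n. a k * w k i)"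
        using w by (intro sum.group fin) auto
      finally show ?thesis .
    qed
    hence "x = (\<lambda>i. \<Sum>v\<in>?V. c v * v i)" using xs by simp
    moreover have "\<forall>v\<in>?V. c v \<ge> 0" unfolding c_def using a by (auto intro: sum_nonneg)
    ultimately show "x \<in> {x \<in> hyp n. \<exists>c. (\<forall>v\<in>?V. c v \<ge> 0) \<and> x = (\<lambda>i. \<Sum>v\<in>?V. c v * v i)}"
      using x by blast
  next
    fix x assume "x \<in> {x \<in> hyp n. \<exists>c. (\<forall>v\<in>?V. c v \<ge> 0) \<and> x = (\<lambda>i. \<Sum>v\<in>?V. c v * v i)}"
    then obtain c where x: "x \<in> hyp n" "\<And>v. v \<in> ?V \<Longrightarrow> c v \<ge> 0" "x = (\<lambda>i. \<Sum>v\<in>?V. c v * v i)"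
      by blast
    have "lor n x e \<le> 0" if e: "e \<in> exceptional n" for e
      unfolding x(3) lor_sum_left[of n c "\<lambda>v. v"]
      using x(2) e by (intro sum_nonpos mult_nonneg_nonpos) (auto simp: vertex_set_def nef_def)
    thus "x \<in> hyp n \<inter> nef n" using x(1) hypD(1)[OF x(1)] by (simp add: nef_def)
  qed
  moreover have "?V \<subseteq> {v. is_vec n v \<and> lor n v v \<le> 0 \<and> v (n+1) > 0}"
    by (auto simp: vertex_set_def)
  moreover have "h_int n (hyp n) (hyp n \<inter> nef n) \<noteq> {}"
    unfolding h_int_hyp_nef[OF n(2)] using normalize_kappa[OF n(2)] by blast
  ultimately show ?thesis
    unfolding polytope_def using fin by blast
qed

text \<open>For adjacent sides \<open><e,f>\<close> is an integer strictly between -1 and 1: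
  \<open>e - f\<close> is orthogonal to \<open>kappa\<close> and \<open>e + f\<close> to a common
  point of the two sides, so both have positive norm.\<close>

lemma right_angled_nef:
  assumes n: "2 \<le> n" "n \<le> 7" shows "right_angled_polytope n (hyp n \<inter> nef n)"
  unfolding right_angled_polytope_def side_normals_eq[OF n]
proof (intro conjI ballI impI)
  show "polytope n (hyp n \<inter> nef n)" by (rule polytope_nef[OF n])
  fix e f assume e: "e \<in> exceptional n" and f: "f \<in> exceptional n"
    and "adjacent_sides n (hyp n \<inter> nef n) e f"
  then obtain x where ef: "e \<noteq> f" and x: "x \<in> hyp n" "lor n x e = 0" "lor n x f = 0"
    unfolding adjacent_sides_def h_int_def by blast
  note E = exceptionalD[OF e] and F = exceptionalD[OF f]
  have xneg: "lor n x x < 0" using hypD(2)[OF x(1)] by simp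
  let ?s = "lc 1 e 1 f"
  have orth: "lor n ?s x = 0" using x by (simp add: lor_commute[of n e x] lor_commute[of n f x])
  have "lor n ?s ?s \<noteq> 0"
  proof
    assume "lor n ?s ?s = 0"
    hence "?s = (\<lambda>_. 0)" using time_orthogonal_null[OF xneg orth] E F by simp
    hence "lor n ?s (kappa n) = 0" by (simp only: lor_zero)
    thus False by (simp add: E F)
  qed
  hence "lor n ?s ?s > 0" using time_orthogonal_nonneg[OF xneg orth] by simp
  hence "-1 < lor n e f" by (simp add: E F lor_commute[of n f e])
  moreover have "lor n e f < 1" using lor_exceptional_less_1[OF n(2) e f ef] .
  moreover have "lor n e f \<in> \<int>" using E F by blast
  ultimately have "lor n e f = 0"
    by (elim Ints_cases) auto
  thus "arccos (- lor n e f) = 0 \<or> arccos (- lor n e f) = pi / 2" by simp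
qed

lemma fundamental_polytope_nef:
  assumes n: "2 \<le> n" "n \<le> 7" shows "fundamental_polytope n (Gamma2 n) (hyp n \<inter> nef n)"
  unfolding fundamental_polytope_def h_int_hyp_nef[OF n(2)] h_closure_nef_int
proof (intro conjI ballI impI)
  show "polytope n (hyp n \<inter> nef n)" by (rule polytope_nef[OF n])
next
  fix g h assume gh: "g \<in> Gamma2 n" "h \<in> Gamma2 n" "g \<noteq> h"
  show "act n g (hyp n \<inter> nef_int n) \<inter> act n h (hyp n \<inter> nef_int n) = {}"
  proof (rule ccontr)
    assume "act n g (hyp n \<inter> nef_int n) \<inter> act n h (hyp n \<inter> nef_int n) \<noteq> {}"
    then obtain x y where xy: "x \<in> nef_int n" "y \<in> nef_int n" "mat_vec n g x = mat_vec n h y"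
      by (auto simp: act_def)
    have "is_vec n y" using xy by (simp add: nef_int_def)
    hence "mat_vec n (mat_mult n (adj n h) g) x = y" using xy(3) gh by simp
    hence "mat_mult n (adj n h) g = idm n"
      using xy gh by (intro Gamma2_nef_int_trivial[OF n _ xy(1)] Gamma2_mult Gamma2_adj) auto
    hence *: "mat_vec n (adj n h) (mat_vec n g z) = z" if "is_vec n z" for z
      using that by (metis mat_vec_idm mat_vec_mat_mult)
    have "g = h"
    proof (rule mat_eqI)
      show "is_mat n g" "is_mat n h" using gh Gamma_lorentzian Gamma2_Gamma
        unfolding lorentzian_def by blast+
      fix z assume "is_vec n z"
      from *[OF this] show "mat_vec n g z = mat_vec n h z"
        using mat_vec_adj_cancel(2)[of n h "mat_vec n g z"] gh by simp
    qed
    thus False using gh by blast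
  qed
next
  show "hyp n = (\<Union>g\<in>Gamma2 n. act n g (hyp n \<inter> nef n))"
  proof (intro equalityI subsetI)
    fix x assume x: "x \<in> hyp n"
    then obtain A where A: "A \<in> Gamma2 n" "mat_vec n (adj n A) x \<in> nef n"
      using Gamma2_covers[OF n] by blast
    have "mat_vec n (adj n A) x \<in> hyp n"
      using A(1) x by (intro hyp_mat_vec Gamma_adj) auto
    moreover have "x = mat_vec n A (mat_vec n (adj n A) x)"
      using A(1) hypD(1)[OF x] by simp
    ultimately show "x \<in> (\<Union>g\<in>Gamma2 n. act n g (hyp n \<inter> nef n))"
      using A unfolding act_def by blast
  next
    fix x assume "x \<in> (\<Union>g\<in>Gamma2 n. act n g (hyp n \<inter> nef n))"
    then obtain g y where "g \<in> Gamma2 n" "y \<in> hyp n" "x = mat_vec n g y"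
      unfolding act_def by blast
    thus "x \<in> hyp n" using hyp_mat_vec[of g n y] by simp
  qed
next
  fix x assume x: "x \<in> hyp n"
  note X = hypD[OF x]
  \<comment> \<open>Bounds cosh of the distance, scaled by the length of \<open>kappa\<close>, to
    any point of a tile seen from \<open>x\<close> with \<open>\<epsilon> = 1\<close>.\<close>
  define D where "D = 4 * \<bar>lor n (kappa n) x\<bar>"
  have "{g \<in> Gamma2 n. \<exists>y\<in>act n g (hyp n \<inter> nef n). - lor n x y < 1 + 1}
      \<subseteq> {A \<in> Gamma2 n. \<bar>lor n (mat_vec n A (kappa n)) (kappa n)\<bar> \<le> 2 * D * D}"
  proof
    fix A assume "A \<in> {g \<in> Gamma2 n. \<exists>y\<in>act n g (hyp n \<inter> nef n). - lor n x y < 1 + 1}"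
    then obtain p where A: "A \<in> Gamma2 n" and p: "p \<in> hyp n" "p \<in> nef n"
      and near: "- lor n x (mat_vec n A p) < 2"
      unfolding act_def by auto
    let ?y = "mat_vec n A p" and ?u = "mat_vec n A (kappa n)"
    have y: "?y \<in> hyp n" using A p(1) by (intro hyp_mat_vec) auto
    note Y = hypD[OF y]
    \<comment> \<open>Descent makes \<open>kappa\<close> the orbit point nearest to
      \<open>p\<close>; transported by \<open>A\<close>, the point \<open>?u\<close> is at least as
      near to \<open>?y\<close> as \<open>kappa\<close>. Both are then within \<open>D\<close> of
      \<open>?y\<close>, which bounds their mutual distance.\<close>
    have "lor n p (mat_vec n (adj n A) (kappa n)) \<le> lor n p (kappa n)"
      using Gamma2_descent[OF n Gamma2_adj[OF A]] p(2) by blast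
    moreover have "lor n p (kappa n) = lor n ?y ?u"
      using A hypD(1)[OF p(1)] by (simp add: lorentzian_lor)
    ultimately have "lor n ?y (kappa n) \<le> lor n ?y ?u"
      by (simp add: lor_mat_vec_left)
    moreover have "lor n ?y ?u < 0" using hyp_lor_kappa_neg[OF n(2) y Gamma2_Gamma[OF A]] .
    ultimately have uy: "\<bar>lor n ?u ?y\<bar> \<le> \<bar>lor n (kappa n) ?y\<bar>"
      unfolding lor_commute[of n ?y] by linarith
    have "\<bar>lor n (kappa n) ?y\<bar> \<le> 2 * \<bar>lor n (kappa n) x\<bar> * \<bar>lor n ?y x\<bar>"
      using X Y n by (intro lor_le_twice_product) auto
    also have "\<dots> \<le> 2 * \<bar>lor n (kappa n) x\<bar> * 2"
      using near hyp_lor_ge1[OF x y] unfolding lor_commute[of n x]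
      by (intro mult_left_mono) auto
    finally have ky: "\<bar>lor n (kappa n) ?y\<bar> \<le> D" by (simp add: D_def)
    have "\<bar>lor n ?u (kappa n)\<bar> \<le> 2 * \<bar>lor n ?u ?y\<bar> * \<bar>lor n (kappa n) ?y\<bar>"
      using Y Gamma_kappa_timelike(1)[OF n(2) Gamma2_Gamma[OF A]] n
      by (intro lor_le_twice_product) auto
    also have "\<dots> \<le> 2 * D * D"
      using uy ky by (intro mult_mono) auto
    finally show "A \<in> {A \<in> Gamma2 n. \<bar>lor n (mat_vec n A (kappa n)) (kappa n)\<bar> \<le> 2 * D * D}"
      using A by blast
  qed
  hence "finite {g \<in> Gamma2 n. \<exists>y\<in>act n g (hyp n \<inter> nef n). - lor n x y < 1 + 1}"
    using Gamma2_kappa_bounded_finite[OF n] by (rule finite_subset)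
  thus "\<exists>\<epsilon>>0. finite {g \<in> Gamma2 n. \<exists>y\<in>act n g (hyp n \<inter> nef n). - lor n x y < 1 + \<epsilon>}"
    by (intro exI[of _ 1]) simp
qed

theorem theorem2p1:
  fixes n :: nat
  assumes "2 \<le> n" and "n \<le> 7"
  shows "right_angled_polytope n (Pn n)
       \<and> fundamental_polytope n (Gamma2 n) (Pn n)
       \<and> Gamma2 n = gen_grp n (side_reflections n (Pn n))"
proof -
  have "side_reflections n (hyp n \<inter> nef n) = lin_refl n 2 ` exceptional n"
    unfolding side_reflections_def side_normals_eq[OF assms]
    by (intro image_cong refl) (simp add: hrefl_def exceptionalD(3))
  thus ?thesis
    unfolding Pn_eq[OF assms]
    using right_angled_nef[OF assms] fundamental_polytope_nef[OF assms] Gamma2_eq_gen_grp[OF assms]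
    by simp
qed

end
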